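(* Let $p\in[1,\infty)$ and $u\in L^{p}(\mathbb{G}^{n}_{\alpha})$. Then $$\frac{2}{p}\liminf_{t\rightarrow0^{+}}t^{-p/2}\int_{\mathbb{G}^{n}_{\alpha}}e^{-t\mathcal{L}}(|u-u(g)|^{p})(g)dg\leq \liminf_{\beta\rightarrow1^{-}}(1-\beta)N_{p,p}^{\mathcal{L},\beta}(u)^{p}$$ $$\leq \limsup_{\beta\rightarrow1^{-}}(1-\beta)N_{p,p}^{\mathcal{L},\beta}(u)^{p}\leq\frac{2}{p}\limsup_{t\rightarrow0^{+}}t^{-p/2}\int_{\mathbb{G}^{n}_{\alpha}}e^{-t\mathcal{L}}(|u-u(g)|^{p})(g)dg.$$ In particular, if $\lim_{\beta\rightarrow1^{-}}(1-\beta)N_{p,p}^{\mathcal{L},\beta}(u)^{p}$ exists, then $$\frac{2}{p}\liminf_{t\rightarrow0^{+}}t^{-p/2}\int_{\mathbb{G}^{n}_{\alpha}}e^{-t\mathcal{L}}(|u-u(g)|^{p})(g)dg\leq \lim_{\beta\rightarrow1^{-}}(1-\beta)N_{p,p}^{\mathcal{L},\beta}(u)^{p}\leq\frac{2}{p}\limsup_{t\rightarrow0^{+}}t^{-p/2}\int_{\mathbb{G}^{n}_{\alpha}}e^{-t\mathcal{L}}(|u-u(g)|^{p})(g)dg.$$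
   Context: Setting. Let $m,k\ge 1$ be integers, $n=m+k$, $\alpha\ge 0$. Points of $\mathbb{R}^n=\mathbb{R}^m\times\mathbb{R}^k$ are written $g=(x,y)$. The Grushin space $\mathbb{G}^n_\alpha$ is $\mathbb{R}^n$ with the Carnot-Carathéodory distance of the vector fields $\partial_{x_i}$ ($1\le i\le m$), $|x|^\alpha\partial_{y_j}$ ($1\le j\le k$), and with Lebesgue measure $dg$. $\mathcal{L}=-\Delta_x-|x|^{2\alpha}\Delta_y$ is the Grushin-Laplace operator (a non-negative self-adjoint operator on $L^2$), and $e^{-t\mathcal{L}}u(g)=\int K_t(g,g')u(g')\,dg'$ is its heat semigroup, with symmetric non-negative heat kernel $K_t$. Besov semi-norm. $e^{-t\mathcal{L}}(|u-u(g)|^p)(g)=\int_{\mathbb{G}^n_\alpha} K_t(g,g')|u(g')-u(g)|^p\,dg'$, and for $\beta>0$ $$N_{p,p}^{\mathcal{L},\beta}(u)=\Big(\int_{0}^{\infty}\int_{\mathbb{G}^{n}_{\alpha}}e^{-t\mathcal{L}}(|u-u(g)|^{p})(g)\,dg\,\frac{dt}{t^{\beta p/2+1}}\Big)^{1/p}\in[0,\infty].$$ *)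

theory Defs
  imports "HOL-Analysis.Analysis"
begin

text \<open>Functions on a Euclidean space are not identified almost everywhere; an element of
  \<open>L\<^sup>p\<close> is represented by any of its Lebesgue measurable representatives.\<close>

definition Lp :: "real \<Rightarrow> ('a::euclidean_space \<Rightarrow> real) set" where
  "Lp p = {u \<in> borel_measurable lebesgue. integrable lebesgue (\<lambda>g. \<bar>u g\<bar> powr p)}"

definition L2_inner :: "('a::euclidean_space \<Rightarrow> real) \<Rightarrow> ('a \<Rightarrow> real) \<Rightarrow> real" where
  "L2_inner u v = (LINT g|lebesgue. u g * v g)"

definition L2_norm :: "('a::euclidean_space \<Rightarrow> real) \<Rightarrow> real" where
  "L2_norm u = sqrt (L2_inner u u)"


section \<open>Test functions\<close>

definition dir_deriv :: "'a::euclidean_space \<Rightarrow> ('a \<Rightarrow> real) \<Rightarrow> 'a \<Rightarrow> real" where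
  "dir_deriv v f g = frechet_derivative f (at g) v"

primrec C_diff :: "nat \<Rightarrow> ('a::euclidean_space \<Rightarrow> real) \<Rightarrow> bool" where
  "C_diff 0 f \<longleftrightarrow> continuous_on UNIV f"
| "C_diff (Suc n) f \<longleftrightarrow> (\<forall>g. f differentiable (at g)) \<and> (\<forall>v. C_diff n (dir_deriv v f))"

definition test_functions :: "('a::euclidean_space \<Rightarrow> real) set" where
  "test_functions = {f. (\<forall>n. C_diff n f) \<and> compact (closure {g. f g \<noteq> 0})}"


section \<open>Self-adjoint operators and contraction semigroups on \<open>L\<^sup>2\<close>\<close>

text \<open>An unbounded operator is given by its graph; the graphs below are saturated with respect
  to equality almost everywhere. Self-adjointness says that the graph coincides with the graph
  of the adjoint; the density requirement on the domain is what makes the adjoint single-valued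
  up to null sets.\<close>

definition dense_domain :: "(('a::euclidean_space \<Rightarrow> real) \<times> ('a \<Rightarrow> real)) set \<Rightarrow> bool" where
  "dense_domain A \<longleftrightarrow> (\<forall>u\<in>Lp 2. \<forall>e>0. \<exists>f\<in>Domain A. L2_norm (\<lambda>g. u g - f g) < e)"

definition adjoint_graph ::
    "(('a::euclidean_space \<Rightarrow> real) \<times> ('a \<Rightarrow> real)) set \<Rightarrow> (('a \<Rightarrow> real) \<times> ('a \<Rightarrow> real)) set" where
  "adjoint_graph A =
    {(f, h). f \<in> Lp 2 \<and> h \<in> Lp 2 \<and> (\<forall>(v, w)\<in>A. L2_inner w f = L2_inner v h)}"

definition nonneg_self_adjoint :: "(('a::euclidean_space \<Rightarrow> real) \<times> ('a \<Rightarrow> real)) set \<Rightarrow> bool" where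
  "nonneg_self_adjoint A \<longleftrightarrow>
     A \<subseteq> Lp 2 \<times> Lp 2 \<and> dense_domain A \<and> adjoint_graph A = A \<and>
     (\<forall>(f, h)\<in>A. L2_inner h f \<ge> 0)"

definition contraction_semigroup :: "(real \<Rightarrow> ('a::euclidean_space \<Rightarrow> real) \<Rightarrow> 'a \<Rightarrow> real) \<Rightarrow> bool" where
  "contraction_semigroup T \<longleftrightarrow>
     (\<forall>t\<ge>0. \<forall>f\<in>Lp 2. T t f \<in> Lp 2 \<and> L2_norm (T t f) \<le> L2_norm f) \<and>
     (\<forall>t\<ge>0. \<forall>f\<in>Lp 2. \<forall>h\<in>Lp 2. \<forall>a b.
        AE g in lebesgue. T t (\<lambda>g. a * f g + b * h g) g = a * T t f g + b * T t h g) \<and>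
     (\<forall>f\<in>Lp 2. AE g in lebesgue. T 0 f g = f g) \<and>
     (\<forall>s\<ge>0. \<forall>t\<ge>0. \<forall>f\<in>Lp 2. AE g in lebesgue. T (s + t) f g = T s (T t f) g) \<and>
     (\<forall>f\<in>Lp 2. ((\<lambda>t. L2_norm (\<lambda>g. T t f g - f g)) \<longlongrightarrow> 0) (at_right 0))"

definition generator ::
    "(real \<Rightarrow> ('a::euclidean_space \<Rightarrow> real) \<Rightarrow> 'a \<Rightarrow> real) \<Rightarrow> (('a \<Rightarrow> real) \<times> ('a \<Rightarrow> real)) set" where
  "generator T =
    {(f, h). f \<in> Lp 2 \<and> h \<in> Lp 2 \<and>
       ((\<lambda>t. L2_norm (\<lambda>g. (T t f g - f g) / t - h g)) \<longlongrightarrow> 0) (at_right 0)}"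

text \<open>\<open>T t\<close> is \<open>exp (- t A)\<close>.\<close>

definition exp_semigroup ::
    "(('a::euclidean_space \<Rightarrow> real) \<times> ('a \<Rightarrow> real)) set \<Rightarrow> (real \<Rightarrow> ('a \<Rightarrow> real) \<Rightarrow> 'a \<Rightarrow> real) \<Rightarrow> bool" where
  "exp_semigroup A T \<longleftrightarrow>
     contraction_semigroup T \<and> generator T = {(f, \<lambda>g. - h g) |f h. (f, h) \<in> A}"


section \<open>The Grushin operator and its heat kernel\<close>

type_synonym ('m, 'k) grushin_space = "(real ^ 'm) \<times> (real ^ 'k)"

text \<open>The coefficient \<open>|x|\<^sup>2\<^sup>\<alpha>\<close>. The case distinction is needed because \<open>0 powr 0 = 0\<close>.\<close>

definition grushin_weight :: "real \<Rightarrow> real ^ 'm::finite \<Rightarrow> real" where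
  "grushin_weight \<alpha> x = (if \<alpha> = 0 then 1 else norm x powr (2 * \<alpha>))"

definition grushin_op ::
    "real \<Rightarrow> (('m::finite, 'k::finite) grushin_space \<Rightarrow> real) \<Rightarrow> ('m, 'k) grushin_space \<Rightarrow> real" where
  "grushin_op \<alpha> f g =
     - (\<Sum>i\<in>Basis. dir_deriv (i, 0) (dir_deriv (i, 0) f) g)
     - grushin_weight \<alpha> (fst g) * (\<Sum>j\<in>Basis. dir_deriv (0, j) (dir_deriv (0, j) f) g)"

text \<open>The Grushin-Laplace operator as a self-adjoint operator. On smooth compactly supported
  functions \<open>grushin_op \<alpha>\<close> is essentially self-adjoint (take the Fourier transform in \<open>y\<close> and
  apply Kato's theorem to the Schroedinger operators with potential \<open>|x|\<^sup>2\<^sup>\<alpha> |\<eta>|\<^sup>2\<close>), so the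
  extension \<open>A\<close> is unique: it is both the closure and the Friedrichs extension.\<close>

definition is_grushin_laplacian ::
    "real \<Rightarrow> ((('m::finite, 'k::finite) grushin_space \<Rightarrow> real) \<times> (('m, 'k) grushin_space \<Rightarrow> real)) set \<Rightarrow> bool" where
  "is_grushin_laplacian \<alpha> A \<longleftrightarrow>
     nonneg_self_adjoint A \<and> (\<forall>f\<in>test_functions. (f, grushin_op \<alpha> f) \<in> A)"

definition is_grushin_heat_kernel ::
    "real \<Rightarrow> (real \<Rightarrow> ('m::finite, 'k::finite) grushin_space \<Rightarrow> ('m, 'k) grushin_space \<Rightarrow> real) \<Rightarrow> bool" where
  "is_grushin_heat_kernel \<alpha> K \<longleftrightarrow>
     (\<lambda>(t, g, g'). K t g g') \<in> borel_measurable (restrict_space borel ({0<..} \<times> UNIV)) \<and>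
     (\<forall>t>0. \<forall>g g'. K t g g' \<ge> 0 \<and> K t g g' = K t g' g) \<and>
     (\<exists>A T. is_grushin_laplacian \<alpha> A \<and> exp_semigroup A T \<and>
        (\<forall>t>0. \<forall>f\<in>Lp 2. AE g in lebesgue.
           integrable lebesgue (\<lambda>g'. K t g g' * f g') \<and>
           T t f g = (LINT g'|lebesgue. K t g g' * f g')))"


section \<open>The heat Besov semi-norm\<close>

text \<open>The heat semigroup applied to a non-negative function, with values in \<open>[0,\<infinity>]\<close>.\<close>

definition heat_apply :: "(real \<Rightarrow> 'a::euclidean_space \<Rightarrow> 'a \<Rightarrow> real) \<Rightarrow> real \<Rightarrow> ('a \<Rightarrow> real) \<Rightarrow> 'a \<Rightarrow> ennreal" where
  "heat_apply K t v g = (\<integral>\<^sup>+ g'. ennreal (K t g g' * v g') \<partial>lebesgue)"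

definition heat_energy :: "(real \<Rightarrow> 'a::euclidean_space \<Rightarrow> 'a \<Rightarrow> real) \<Rightarrow> real \<Rightarrow> ('a \<Rightarrow> real) \<Rightarrow> real \<Rightarrow> ennreal" where
  "heat_energy K p u t =
     (\<integral>\<^sup>+ g. heat_apply K t (\<lambda>g'. \<bar>u g' - u g\<bar> powr p) g \<partial>lebesgue)"

text \<open>Powers on \<open>[0,\<infinity>]\<close> with exponent \<open>a > 0\<close>.\<close>

definition ennreal_rpow :: "ennreal \<Rightarrow> real \<Rightarrow> ennreal" where
  "ennreal_rpow x a = (if x = \<infinity> then \<infinity> else ennreal (enn2real x powr a))"

definition besov_seminorm :: "(real \<Rightarrow> 'a::euclidean_space \<Rightarrow> 'a \<Rightarrow> real) \<Rightarrow> real \<Rightarrow> real \<Rightarrow> ('a \<Rightarrow> real) \<Rightarrow> ennreal" where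
  "besov_seminorm K p \<beta> u =
     ennreal_rpow
       (\<integral>\<^sup>+ t\<in>{0<..}. (heat_energy K p u t * ennreal (1 / t powr (\<beta> * p / 2 + 1))) \<partial>lebesgue)
       (1 / p)"

end

theory Submission
  imports Defs
begin

text \<open>
  Write \<open>E t\<close> for \<open>heat_energy K p u t\<close>. The \<open>p\<close>-th power of the Besov semi-norm is the integral of
  \<open>E t\<close> against \<open>t powr (- \<beta> * p / 2 - 1)\<close>, and the theorem is an Abelian statement about this integral.
  If \<open>E t\<close> is at least (at most) \<open>c * t powr (p / 2)\<close> on \<open>(0, \<delta>]\<close>, then this range of \<open>t\<close> contributes
  at least (at most) \<open>c * \<delta> powr a / a\<close> with \<open>a = p * (1 - \<beta>) / 2\<close>, and
  \<open>(1 - \<beta>) * c * \<delta> powr a / a\<close> tends to \<open>2 / p * c\<close>. This gives the lower bound at once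
  (\<open>abelian_liminf\<close>). For the upper bound (\<open>abelian_limsup\<close>) the range \<open>t > \<delta>\<close> must be negligible, which
  holds as soon as \<open>E\<close> is bounded on \<open>(0, \<infinity>)\<close>.

  Since \<open>\<bar>a - b\<bar> powr p \<le> 2 powr p * (\<bar>a\<bar> powr p + \<bar>b\<bar> powr p)\<close> and the kernel is symmetric, \<open>E\<close> is bounded
  by a multiple of \<open>\<integral>\<bar>u\<bar> powr p\<close> once the total mass of \<open>K t g\<close> is bounded, uniformly in \<open>t\<close> and for
  almost every \<open>g\<close> (\<open>heat_energy_bound\<close>). This mass bound (\<open>grushin_heat_kernel_mass\<close>) is the
  substantial part. It has to come from what characterises the semigroup: it is a positive contraction
  semigroup on \<open>L\<^sup>2\<close> whose generator is \<open>- grushin_op \<alpha>\<close> on test functions.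

  The idea is to follow the mass seen through a smooth window. Let \<open>\<phi>\<close> be a smooth bump on the unit
  ball and \<open>\<phi> R\<close> its composition with the anisotropic dilation \<open>(x, y) \<mapsto> (x / R, y / R powr (1 + \<alpha>))\<close>.
  The Grushin operator is homogeneous of degree two under these dilations, and \<open>\<phi> (2 * R)\<close> is
  bounded below where \<open>\<phi> R\<close> lives, so \<open>\<bar>grushin_op \<alpha> (\<phi> R)\<bar> \<le> C / R\<^sup>2 * \<phi> (2 * R)\<close>. For the
  indicator \<open>f\<close> of a set of finite measure put
  \<open>m R s = L2_inner f (T s (\<phi> R))\<close>. Duhamel's formula and positivity give, for \<open>0 \<le> s \<le> t\<close>,
  \<open>m R s \<le> \<integral>f + t * C / R\<^sup>2 * sup {m (2 * R) r | r. 0 \<le> r \<le> t}\<close>.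
  In the iteration along \<open>R, 2 * R, 4 * R, \<dots>\<close>, for large \<open>R\<close>, each step gains a fixed small factor, and
  this beats the growth of \<open>m\<close>, which by Cauchy-Schwarz is at most polynomial in \<open>R\<close>. Hence \<open>m R t \<le> 2 * \<integral>f\<close> for all
  large \<open>R\<close>, that is \<open>T t (\<phi> R) \<le> 2\<close> almost everywhere, and \<open>R \<rightarrow> \<infinity>\<close> with Fatou's lemma bounds
  the mass of the kernel.
\<close>

section \<open>Smooth functions and a compactly supported bump\<close>

lemma C_diff_Suc_D: "C_diff (Suc n) f \<Longrightarrow> C_diff n f"
proof (induction n arbitrary: f)
  case 0
  then show ?case
    by (auto simp: continuous_on_eq_continuous_at intro: differentiable_imp_continuous_within)
next
  case (Suc n)
  from Suc.prems Suc.IH show ?case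
    by (subst C_diff.simps(2)) (metis C_diff.simps(2))
qed

lemma dir_deriv_eqI:
  assumes "(f has_derivative f') (at g)"
  shows "dir_deriv v f g = f' v"
  using frechet_derivative_at[OF assms] by (simp add: dir_deriv_def)

lemma differentiable_has_derivative_dir_deriv:
  assumes "f differentiable (at g)"
  shows "(f has_derivative (\<lambda>v. dir_deriv v f g)) (at g)"
  using assms unfolding dir_deriv_def frechet_derivative_works .

lemma dir_deriv_scaleR:
  assumes "f differentiable (at g)"
  shows "dir_deriv (c *\<^sub>R v) f g = c * dir_deriv v f g"
  using linear_scale[OF linear_frechet_derivative[OF assms]] by (simp add: dir_deriv_def)

lemma dir_deriv_add:
  assumes "f differentiable (at g)" "h differentiable (at g)"
  shows "dir_deriv v (\<lambda>g. f g + h g) g = dir_deriv v f g + dir_deriv v h g"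
  by (rule dir_deriv_eqI[OF has_derivative_add])
     (intro differentiable_has_derivative_dir_deriv assms)+

lemma dir_deriv_mult:
  assumes "f differentiable (at g)" "h differentiable (at g)"
  shows "dir_deriv v (\<lambda>g. f g * h g) g = f g * dir_deriv v h g + dir_deriv v f g * h g"
  by (rule dir_deriv_eqI[OF has_derivative_mult])
     (intro differentiable_has_derivative_dir_deriv assms)+

lemma dir_deriv_compose_real:
  assumes "(\<phi> has_real_derivative d) (at (f g))" "f differentiable (at g)"
  shows "dir_deriv v (\<lambda>g. \<phi> (f g)) g = d * dir_deriv v f g"
  by (rule dir_deriv_eqI[OF has_derivative_compose])
     (use assms differentiable_has_derivative_dir_deriv in \<open>auto simp: has_field_derivative_def\<close>)

lemma dir_deriv_compose_linear:
  assumes "bounded_linear D" "f differentiable (at (D g))"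
  shows "dir_deriv v (\<lambda>g. f (D g)) g = dir_deriv (D v) f (D g)"
  by (rule dir_deriv_eqI[OF has_derivative_compose])
     (use assms bounded_linear_imp_has_derivative differentiable_has_derivative_dir_deriv in auto)

lemma dir_deriv_eq_0_on_open:
  assumes "open U" "\<And>x. x \<in> U \<Longrightarrow> f x = 0" "g \<in> U"
  shows "dir_deriv v f g = 0"
proof -
  have "((\<lambda>_. 0) has_derivative (\<lambda>_. 0)) (at g)" by simp
  then have "(f has_derivative (\<lambda>_. 0)) (at g)"
    by (rule has_derivative_transform_within_open[OF _ assms(1,3)]) (simp add: assms(2))
  then show ?thesis by (rule dir_deriv_eqI)
qed

lemma C_diff_const: "C_diff n (\<lambda>_. c)"
proof (induction n arbitrary: c)
  case (Suc n)
  have "dir_deriv v (\<lambda>_::'a. c) = (\<lambda>_. 0)" for v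
    by (rule ext, rule dir_deriv_eqI) simp
  then show ?case by (simp add: Suc.IH)
qed simp

lemma C_diff_add: "C_diff n f \<Longrightarrow> C_diff n h \<Longrightarrow> C_diff n (\<lambda>g. f g + h g)"
proof (induction n arbitrary: f h)
  case (Suc n)
  then have "dir_deriv v (\<lambda>g. f g + h g) = (\<lambda>g. dir_deriv v f g + dir_deriv v h g)" for v
    by (intro ext dir_deriv_add) auto
  with Suc show ?case by simp
qed (auto intro: continuous_intros)

lemma C_diff_mult: "C_diff n f \<Longrightarrow> C_diff n h \<Longrightarrow> C_diff n (\<lambda>g. f g * h g)"
proof (induction n arbitrary: f h)
  case (Suc n)
  then have "dir_deriv v (\<lambda>g. f g * h g) = (\<lambda>g. f g * dir_deriv v h g + dir_deriv v f g * h g)" for v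
    by (intro ext dir_deriv_mult) auto
  moreover have "C_diff n f" "C_diff n h"
    using Suc.prems C_diff_Suc_D by blast+
  ultimately show ?case using Suc by (auto intro!: C_diff_add)
qed (auto intro: continuous_intros)

lemma C_diff_compose_linear:
  assumes D: "bounded_linear D"
  shows "C_diff n f \<Longrightarrow> C_diff n (\<lambda>g. f (D g))"
proof (induction n arbitrary: f)
  case 0
  then show ?case
    using D by (auto intro!: continuous_on_compose2[of UNIV f] simp: linear_continuous_on)
next
  case (Suc n)
  have "(\<lambda>g. f (D g)) differentiable (at g)" for g
    using differentiable_compose[of f D g] Suc.prems bounded_linear_imp_differentiable[OF D] by simp
  moreover have "dir_deriv v (\<lambda>g. f (D g)) = (\<lambda>g. dir_deriv (D v) f (D g))" for v
    using Suc.prems D by (intro ext dir_deriv_compose_linear) auto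
  ultimately show ?case using Suc by simp
qed

lemma C_diff_inner_left: "C_diff n (\<lambda>g. g \<bullet> v)"
proof (cases n)
  case (Suc m)
  have d: "((\<lambda>g. g \<bullet> v) has_derivative (\<lambda>w. w \<bullet> v)) (at g)" for g
    by (auto intro!: derivative_eq_intros)
  have "dir_deriv w (\<lambda>g. g \<bullet> v) = (\<lambda>_. w \<bullet> v)" for w
    by (rule ext, rule dir_deriv_eqI, rule d)
  then show ?thesis using d Suc by (auto simp: C_diff_const differentiable_def)
qed (auto intro: continuous_intros)

lemma C_diff_inner_self: "C_diff n (\<lambda>g. g \<bullet> g)"
proof (cases n)
  case (Suc m)
  have d: "((\<lambda>g. g \<bullet> g) has_derivative (\<lambda>w. 2 * (g \<bullet> w))) (at g)" for g::'a
    by (auto intro!: derivative_eq_intros simp: inner_commute)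
  have "dir_deriv w (\<lambda>g. g \<bullet> g) = (\<lambda>g. 2 * (g \<bullet> w))" for w::'a
    by (rule ext, rule dir_deriv_eqI, rule d)
  then show ?thesis using d Suc
    by (auto simp: differentiable_def intro!: C_diff_mult C_diff_const C_diff_inner_left)
qed (auto intro: continuous_intros)

text \<open>The functions \<open>x\<^sup>-\<^sup>n exp (- 1 / x)\<close>, extended by zero to \<open>x \<le> 0\<close>. The whole family is used because
  it is closed under differentiation up to linear combinations, which makes smoothness an induction
  over all \<open>n\<close> at once.\<close>
definition flat :: "nat \<Rightarrow> real \<Rightarrow> real" where
  "flat n x = (if x > 0 then inverse x ^ n * exp (- inverse x) else 0)"

lemma flat_tendsto_0: "(flat n \<longlongrightarrow> 0) (at_right 0)"
proof -
  have "((\<lambda>x. inverse x ^ n / exp (inverse x)) \<longlongrightarrow> (0::real)) (at_right 0)"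
    by (rule filterlim_compose[OF tendsto_power_div_exp_0 filterlim_inverse_at_top_right])
  then show ?thesis
    by (rule Lim_transform_eventually)
       (auto simp: eventually_at_filter flat_def exp_minus divide_inverse)
qed

lemma flat_has_real_derivative:
  "(flat n has_real_derivative (flat (n + 2) x - real n * flat (n + 1) x)) (at x)"
proof -
  consider "x < 0" | "x = 0" | "x > 0" by linarith
  then show ?thesis
  proof cases
    case 1
    have "((\<lambda>_. 0) has_real_derivative 0) (at x)" by simp
    then have "(flat n has_real_derivative 0) (at x)"
      by (rule has_field_derivative_transform_within_open[of _ _ _ "{..<0}"])
         (use 1 in \<open>auto simp: flat_def\<close>)
    then show ?thesis using 1 by (simp add: flat_def)
  next
    case 2
    \<comment> \<open>To the right of zero the difference quotient of \<open>flat n\<close> is \<open>flat (n + 1)\<close>.\<close>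
    have "((\<lambda>y. (flat n y - flat n 0) / (y - 0)) \<longlongrightarrow> 0) (at_right 0)"
      by (rule Lim_transform_eventually[OF flat_tendsto_0[of "n + 1"]])
         (auto simp: eventually_at_filter flat_def field_simps)
    moreover have "((\<lambda>y. (flat n y - flat n 0) / (y - 0)) \<longlongrightarrow> 0) (at_left 0)"
      by (rule tendsto_eventually) (auto simp: eventually_at_filter flat_def)
    ultimately have "((\<lambda>y. (flat n y - flat n 0) / (y - 0)) \<longlongrightarrow> 0) (at 0)"
      by (simp add: filterlim_split_at)
    then show ?thesis using 2 by (simp add: has_field_derivative_iff flat_def)
  next
    case 3
    have "((\<lambda>x. inverse x ^ n * exp (- inverse x)) has_real_derivative
        (flat (n + 2) x - real n * flat (n + 1) x)) (at x)"
      using 3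
      by (auto intro!: derivative_eq_intros simp: flat_def)
         (cases n; simp add: field_simps power2_eq_square)
    then show ?thesis
      by (rule has_field_derivative_transform_within_open[of _ _ _ "{0<..}"])
         (use 3 in \<open>auto simp: flat_def\<close>)
  qed
qed

lemma flat_nonneg: "flat n x \<ge> 0"
  by (simp add: flat_def)

lemma flat_0_mono: "x \<le> y \<Longrightarrow> flat 0 x \<le> flat 0 y"
  by (auto simp: flat_def)

lemma flat_0_le_1: "flat 0 x \<le> 1"
  by (simp add: flat_def)

lemma C_diff_flat_compose:
  assumes "\<And>N. C_diff N q"
  shows "C_diff N (\<lambda>g. flat n (q g))"
proof (induction N arbitrary: n)
  case 0
  have "continuous_on UNIV (flat n)"
    using flat_has_real_derivative[THEN DERIV_isCont] by (simp add: continuous_on_eq_continuous_at)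
  moreover have "continuous_on UNIV q" using assms[of 0] by simp
  ultimately show ?case by (auto intro: continuous_on_compose2)
next
  case (Suc N)
  have q: "q differentiable (at g)" for g using assms[of 1] by simp
  have "(\<lambda>g. flat n (q g)) differentiable (at g)" for g
    using differentiable_compose[OF _ q, of "flat n"] flat_has_real_derivative
    by (metis real_differentiable_def)
  moreover have "dir_deriv v (\<lambda>g. flat n (q g))
      = (\<lambda>g. (flat (n + 2) (q g) + (- real n) * flat (n + 1) (q g)) * dir_deriv v q g)" for v
    using dir_deriv_compose_real[OF flat_has_real_derivative q] by auto
  moreover have "C_diff N (dir_deriv v q)" for v
    using assms[of "Suc N"] by simp
  then have "C_diff N (\<lambda>g. (flat (n + 2) (q g) + (- real n) * flat (n + 1) (q g)) * dir_deriv v q g)" for v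
    by (intro C_diff_mult C_diff_add C_diff_const Suc)
  ultimately show ?case by (simp only: C_diff.simps) blast
qed

definition bump :: "'a::euclidean_space \<Rightarrow> real" where
  "bump g = flat 0 (1 - g \<bullet> g)"

lemma C_diff_bump: "C_diff N bump"
proof -
  have "C_diff N (\<lambda>g::'a. 1 + (-1) * (g \<bullet> g))" for N
    by (intro C_diff_add C_diff_mult C_diff_const C_diff_inner_self)
  from C_diff_flat_compose[of "\<lambda>g::'a. 1 + (-1) * (g \<bullet> g)", OF this]
  show ?thesis by (simp add: bump_def[abs_def])
qed

lemma bump_eq_0: "norm g \<ge> 1 \<Longrightarrow> bump g = 0"
  using power_mono[of 1 "norm g" 2] by (simp add: bump_def flat_def power2_norm_eq_inner)

lemma bump_nonneg: "bump g \<ge> 0" and bump_le_1: "bump g \<le> 1"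
  by (simp_all add: bump_def flat_nonneg flat_0_le_1)

section \<open>Dilations of the Grushin space\<close>

text \<open>The chain rule along an eigenvector of the linear map, applied twice; the coordinate directions are
  eigenvectors of the dilations below.\<close>
lemma second_dir_deriv_compose_linear:
  assumes D: "bounded_linear D" and f: "C_diff 2 f" and v: "D v = c *\<^sub>R v"
  shows "dir_deriv v (dir_deriv v (\<lambda>g. f (D g))) g = c\<^sup>2 * dir_deriv v (dir_deriv v f) (D g)"
proof -
  have df: "f differentiable (at x)" and ddf: "dir_deriv v f differentiable (at x)" for x
    using f by (auto simp: numeral_2_eq_2)
  have d1: "dir_deriv v (\<lambda>g. f (D g)) = (\<lambda>g. c * dir_deriv v f (D g))"
  proof
    fix g
    have "dir_deriv v (\<lambda>g. f (D g)) g = dir_deriv (D v) f (D g)"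
      by (rule dir_deriv_compose_linear[OF D df])
    then show "dir_deriv v (\<lambda>g. f (D g)) g = c * dir_deriv v f (D g)"
      by (simp add: v dir_deriv_scaleR[OF df])
  qed
  have dd: "(\<lambda>g. dir_deriv v f (D g)) differentiable (at g)"
    using differentiable_compose[of "dir_deriv v f" D g] ddf bounded_linear_imp_differentiable[OF D] by simp
  have "dir_deriv v (\<lambda>g. c * dir_deriv v f (D g)) g = c * dir_deriv v (\<lambda>g. dir_deriv v f (D g)) g"
    by (rule dir_deriv_eqI[OF has_derivative_mult_right])
       (rule differentiable_has_derivative_dir_deriv[OF dd])
  also have "dir_deriv v (\<lambda>g. dir_deriv v f (D g)) g = dir_deriv (D v) (dir_deriv v f) (D g)"
    by (rule dir_deriv_compose_linear[OF D ddf])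
  finally show ?thesis
    unfolding d1 by (simp add: v dir_deriv_scaleR[OF ddf] power2_eq_square)
qed

text \<open>The Grushin dilation with factor \<open>1 / R\<close>; the exponent \<open>1 + \<alpha>\<close> in the second component makes
  \<open>grushin_op \<alpha>\<close> homogeneous.\<close>
definition dilate :: "real \<Rightarrow> real \<Rightarrow> ('m::finite, 'k::finite) grushin_space \<Rightarrow> ('m, 'k) grushin_space" where
  "dilate \<alpha> R g = ((1 / R) *\<^sub>R fst g, (1 / R powr (1 + \<alpha>)) *\<^sub>R snd g)"

lemma bounded_linear_dilate: "bounded_linear (dilate \<alpha> R)"
  unfolding dilate_def[abs_def]
  by (intro bounded_linear_Pair bounded_linear_const_scaleR bounded_linear_fst bounded_linear_snd)

lemma grushin_weight_dilate:
  assumes "R > 0"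
  shows "grushin_weight \<alpha> x = R powr (2 * \<alpha>) * grushin_weight \<alpha> ((1 / R) *\<^sub>R x)"
  using assms by (simp add: grushin_weight_def powr_divide)

text \<open>The weight at \<open>g\<close> is \<open>R powr (2 * \<alpha>)\<close> times the weight at \<open>dilate \<alpha> R g\<close>, while second derivatives in
  \<open>y\<close> scale by \<open>R powr (- 2 - 2 * \<alpha>)\<close>; the product is the \<open>R\<^sup>-\<^sup>2\<close> of the derivatives in \<open>x\<close>.\<close>
lemma grushin_op_dilate:
  assumes R: "R > 0" and f: "C_diff 2 f"
  shows "grushin_op \<alpha> (\<lambda>g. f (dilate \<alpha> R g)) g = grushin_op \<alpha> f (dilate \<alpha> R g) / R\<^sup>2"
proof -
  let ?D = "dilate \<alpha> R"
  have x: "dir_deriv (i, 0) (dir_deriv (i, 0) (\<lambda>g. f (?D g))) g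
      = (1 / R)\<^sup>2 * dir_deriv (i, 0) (dir_deriv (i, 0) f) (?D g)" for i
    by (rule second_dir_deriv_compose_linear[OF bounded_linear_dilate f]) (simp add: dilate_def)
  have y: "dir_deriv (0, j) (dir_deriv (0, j) (\<lambda>g. f (?D g))) g
      = (1 / R powr (1 + \<alpha>))\<^sup>2 * dir_deriv (0, j) (dir_deriv (0, j) f) (?D g)" for j
    by (rule second_dir_deriv_compose_linear[OF bounded_linear_dilate f]) (simp add: dilate_def)
  have e: "R powr (2 * \<alpha>) * (1 / R powr (1 + \<alpha>))\<^sup>2 = (1 / R)\<^sup>2"
  proof -
    have "R powr (1 + \<alpha>) = R * R powr \<alpha>" "R powr (2 * \<alpha>) = (R powr \<alpha>)\<^sup>2"
      using R powr_add[of R 1 \<alpha>] powr_add[of R \<alpha> \<alpha>] by (simp_all add: power2_eq_square)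
    then show ?thesis using R by (simp add: power_divide power_mult_distrib)
  qed
  have "grushin_weight \<alpha> (fst g) * (1 / R powr (1 + \<alpha>))\<^sup>2
      = (R powr (2 * \<alpha>) * (1 / R powr (1 + \<alpha>))\<^sup>2) * grushin_weight \<alpha> (fst (?D g))"
    using grushin_weight_dilate[OF R, of \<alpha> "fst g"] by (simp add: dilate_def)
  then have w: "grushin_weight \<alpha> (fst g) * (1 / R powr (1 + \<alpha>))\<^sup>2
      = (1 / R)\<^sup>2 * grushin_weight \<alpha> (fst (?D g))" unfolding e .
  show ?thesis
    unfolding grushin_op_def x y sum_distrib_left[symmetric] mult.assoc[symmetric] w
    by (simp add: power_divide diff_divide_distrib)
qed

lemma norm_dilate_double:
  assumes "\<alpha> \<ge> 0" "R > 0"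
  shows "norm (dilate \<alpha> (2 * R) g) \<le> norm (dilate \<alpha> R g) / 2"
proof -
  define x y where "x = (1 / R) *\<^sub>R fst g" and "y = (1 / R powr (1 + \<alpha>)) *\<^sub>R snd g"
  define c :: real where "c = 1 / 2 powr (1 + \<alpha>)"
  have "(2::real) powr 1 \<le> 2 powr (1 + \<alpha>)" using assms by (intro powr_mono) auto
  then have c: "0 \<le> c" "c \<le> 1 / 2" by (auto simp: c_def field_simps)
  have 1: "dilate \<alpha> (2 * R) g = ((1 / 2) *\<^sub>R x, c *\<^sub>R y)"
    using assms by (simp add: dilate_def x_def y_def c_def powr_mult)
  have "(norm ((1 / 2) *\<^sub>R x, c *\<^sub>R y))\<^sup>2 = (1 / 2)\<^sup>2 * (norm x)\<^sup>2 + c\<^sup>2 * (norm y)\<^sup>2"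
    by (simp add: norm_Pair power_mult_distrib power_divide)
  also have "\<dots> \<le> (1 / 2)\<^sup>2 * (norm x)\<^sup>2 + (1 / 2)\<^sup>2 * (norm y)\<^sup>2"
    using c by (intro add_left_mono mult_right_mono power_mono) auto
  also have "\<dots> = (norm (x, y) / 2)\<^sup>2"
    by (simp add: norm_Pair power_divide)
  finally have "norm ((1 / 2) *\<^sub>R x, c *\<^sub>R y) \<le> norm (x, y) / 2"
    by (rule power2_le_imp_le) simp
  then show ?thesis unfolding 1 by (simp add: dilate_def x_def y_def)
qed

lemma norm_le_dilate:
  assumes "\<alpha> \<ge> 0" "R \<ge> 1" "norm (dilate \<alpha> R g) \<le> 1"
  shows "norm g \<le> 2 * R powr (1 + \<alpha>)"
proof -
  have "R powr 1 \<le> R powr (1 + \<alpha>)" using assms by (intro powr_mono) auto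
  then have R: "R \<le> R powr (1 + \<alpha>)" using assms by simp
  have "norm (fst (dilate \<alpha> R g)) \<le> 1" "norm (snd (dilate \<alpha> R g)) \<le> 1"
    using norm_fst_le[of "fst (dilate \<alpha> R g)" "snd (dilate \<alpha> R g)"]
      norm_snd_le[of "snd (dilate \<alpha> R g)" "fst (dilate \<alpha> R g)"] assms(3) by auto
  then have "norm (fst g) \<le> R" "norm (snd g) \<le> R powr (1 + \<alpha>)"
    using assms by (auto simp: dilate_def field_simps)
  moreover have "norm g \<le> norm (fst g) + norm (snd g)"
    by (metis norm_Pair_le prod.collapse)
  ultimately show ?thesis using R by simp
qed

lemma continuous_grushin_weight:
  assumes "\<alpha> \<ge> 0"
  shows "continuous_on UNIV (\<lambda>x :: real ^ 'm::finite. grushin_weight \<alpha> x)"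
proof (cases "\<alpha> = 0")
  case False
  have "continuous_on UNIV (\<lambda>x :: real ^ 'm. norm x powr (2 * \<alpha>))"
    using False assms by (intro continuous_on_powr' continuous_intros) auto
  with False show ?thesis by (simp add: grushin_weight_def)
qed (simp add: grushin_weight_def)

lemma continuous_grushin_op:
  assumes "\<alpha> \<ge> 0" and f: "C_diff 2 f"
  shows "continuous_on UNIV (grushin_op \<alpha> f)"
proof -
  have c: "continuous_on UNIV (dir_deriv v (dir_deriv v f))" for v
    using f by (simp add: numeral_2_eq_2 del: split_paired_All)
  have w: "continuous_on UNIV (\<lambda>g::('a, 'b) grushin_space. grushin_weight \<alpha> (fst g))"
    by (rule continuous_on_compose2[OF continuous_grushin_weight[OF assms(1)]])
       (auto intro: continuous_intros)
  show ?thesis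
    unfolding grushin_op_def[abs_def] by (intro continuous_intros c w)
qed

lemma grushin_op_bump_eq_0:
  assumes "norm g > 1"
  shows "grushin_op \<alpha> bump g = 0"
proof -
  have U: "open (- cball 0 1 :: ('a, 'b) grushin_space set)" by auto
  have 1: "dir_deriv v bump x = 0" if "x \<in> - cball 0 1" for v x :: "('a, 'b) grushin_space"
    by (rule dir_deriv_eq_0_on_open[OF U _ that]) (auto intro: bump_eq_0)
  have "dir_deriv v (dir_deriv v bump) g = 0" for v
    by (rule dir_deriv_eq_0_on_open[OF U 1]) (use assms in auto)
  then show ?thesis by (simp add: grushin_op_def)
qed

text \<open>The bump does not dominate its own Grushin Laplacian, because its second derivatives decay more
  slowly than the bump itself at the edge of its support. They are dominated by the bump of twice the
  size, since the support of the smaller one lies well inside the larger. For \<open>R = 1\<close> this is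
  compactness, and homogeneity transports it to all \<open>R\<close>.\<close>
lemma grushin_op_bump_bound:
  assumes "\<alpha> \<ge> 0"
  obtains C where "C \<ge> 0"
    "\<And>R g. R > 0 \<Longrightarrow> \<bar>grushin_op \<alpha> (\<lambda>g. bump (dilate \<alpha> R g)) (g :: ('m::finite, 'k::finite) grushin_space)\<bar>
        \<le> C / R\<^sup>2 * bump (dilate \<alpha> (2 * R) g)"
proof -
  let ?L = "grushin_op \<alpha> (bump :: ('m, 'k) grushin_space \<Rightarrow> real)"
  have "compact (?L ` cball 0 1)"
    using continuous_grushin_op[OF assms C_diff_bump]
    by (intro compact_continuous_image) (auto intro: continuous_on_subset)
  then obtain B where B: "\<And>g. g \<in> cball 0 1 \<Longrightarrow> \<bar>?L g\<bar> \<le> B"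
    using compact_imp_bounded[THEN bounded_iff[THEN iffD1]] by force
  have "\<bar>?L 0\<bar> \<le> B" by (rule B) simp
  then have B0: "B \<ge> 0" by (rule order_trans[OF abs_ge_zero])
  \<comment> \<open>A lower bound for the bump of double size on the support of the smaller one: its argument has norm at most \<open>1 / 2\<close> there, and \<open>1 - (1 / 2)\<^sup>2 = 3 / 4\<close>.\<close>
  define c where "c = flat 0 (3 / 4)"
  have c: "c > 0" by (simp add: c_def flat_def)
  have *: "\<bar>?L (dilate \<alpha> R g)\<bar> \<le> B / c * bump (dilate \<alpha> (2 * R) g)" if R: "R > 0" for R g
  proof (cases "norm (dilate \<alpha> R g) > 1")
    case True
    then show ?thesis using B0 c by (simp add: grushin_op_bump_eq_0 bump_nonneg)
  next
    case False
    then have "norm (dilate \<alpha> (2 * R) g) \<le> 1 / 2"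
      using norm_dilate_double[OF assms R, of g] by simp
    then have "(norm (dilate \<alpha> (2 * R) g))\<^sup>2 \<le> (1 / 2)\<^sup>2"
      by (intro power_mono) auto
    then have "c \<le> bump (dilate \<alpha> (2 * R) g)"
      unfolding c_def bump_def power2_norm_eq_inner[symmetric]
      by (intro flat_0_mono) (simp add: power2_eq_square)
    then have "B / c * c \<le> B / c * bump (dilate \<alpha> (2 * R) g)"
      using B0 c by (intro mult_left_mono) auto
    moreover have "\<bar>?L (dilate \<alpha> R g)\<bar> \<le> B" using False by (intro B) auto
    ultimately show ?thesis using c by simp
  qed
  show thesis
  proof (rule that[of "B / c"])
    show "B / c \<ge> 0" using B0 c by simp
    fix R :: real and g :: "('m, 'k) grushin_space"
    assume R: "R > 0"
    have "\<bar>?L (dilate \<alpha> R g)\<bar> / R\<^sup>2 \<le> B / c * bump (dilate \<alpha> (2 * R) g) / R\<^sup>2"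
      using *[OF R, of g] by (intro divide_right_mono) auto
    then show "\<bar>grushin_op \<alpha> (\<lambda>g. bump (dilate \<alpha> R g)) g\<bar> \<le> B / c / R\<^sup>2 * bump (dilate \<alpha> (2 * R) g)"
      unfolding grushin_op_dilate[OF R C_diff_bump] by (simp add: abs_divide)
  qed
qed

lemma bump_dilate_test_function:
  assumes "R > 0"
  shows "(\<lambda>g. bump (dilate \<alpha> R g)) \<in> test_functions"
proof -
  have "bounded {g. bump (dilate \<alpha> R g) \<noteq> 0}"
  proof (rule bounded_subset[of "cball 0 R \<times> cball 0 (R powr (1 + \<alpha>))"])
    show "{g. bump (dilate \<alpha> R g) \<noteq> 0} \<subseteq> cball 0 R \<times> cball 0 (R powr (1 + \<alpha>))"
    proof clarify
      fix x y assume "bump (dilate \<alpha> R (x, y)) \<noteq> 0"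
      then have "norm (dilate \<alpha> R (x, y)) < 1" using bump_eq_0 linorder_not_le by blast
      then have "norm (fst (dilate \<alpha> R (x, y))) < 1" "norm (snd (dilate \<alpha> R (x, y))) < 1"
        using norm_fst_le[of "fst (dilate \<alpha> R (x, y))" "snd (dilate \<alpha> R (x, y))"]
          norm_snd_le[of "snd (dilate \<alpha> R (x, y))" "fst (dilate \<alpha> R (x, y))"] by auto
      then show "x \<in> cball 0 R \<and> y \<in> cball 0 (R powr (1 + \<alpha>))"
        using assms by (auto simp: dilate_def field_simps)
    qed
  qed (auto intro: bounded_Times)
  then show ?thesis
    by (auto simp: test_functions_def C_diff_compose_linear[OF bounded_linear_dilate C_diff_bump])
qed

text \<open>The bump is at most one and vanishes outside a ball whose radius is a multiple of a power of \<open>R\<close>.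
  This polynomial growth provides the crude bound in \<open>mass_iteration\<close>.\<close>
lemma L2_norm_bump_dilate:
  fixes \<alpha> :: real
  assumes "\<alpha> \<ge> 0"
  obtains W d where "\<And>R. R \<ge> 1 \<Longrightarrow>
    L2_norm (\<lambda>g :: ('m::finite, 'k::finite) grushin_space. bump (dilate \<alpha> R g)) \<le> W * R powr d"
proof -
  define n where "n = DIM(('m, 'k) grushin_space)"
  define c where "c = unit_ball_vol (real n) * 2 ^ n"
  have c: "c \<ge> 0" by (simp add: c_def)
  show thesis
  proof (rule that[of "sqrt c" "(1 + \<alpha>) * real n / 2"])
    fix R :: real assume R: "R \<ge> 1"
    let ?\<phi> = "\<lambda>g :: ('m, 'k) grushin_space. bump (dilate \<alpha> R g)"
    let ?B = "cball 0 (2 * R powr (1 + \<alpha>)) :: ('m, 'k) grushin_space set"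
    have "L2_inner ?\<phi> ?\<phi> \<le> (LINT g|lebesgue. indicator ?B g)"
      unfolding L2_inner_def
    proof (rule integral_mono')
      show "integrable lebesgue (indicator ?B :: _ \<Rightarrow> real)"
        using emeasure_lborel_cball_finite by (intro integrable_real_indicator) auto
      fix g
      show "0 \<le> (indicator ?B g :: real)" by simp
      show "?\<phi> g * ?\<phi> g \<le> indicator ?B g"
      proof (cases "norm (dilate \<alpha> R g) \<le> 1")
        case True
        then have "g \<in> ?B" using norm_le_dilate[OF assms R] by simp
        then show ?thesis
          using mult_mono[OF bump_le_1 bump_le_1 zero_le_one bump_nonneg, of "dilate \<alpha> R g" "dilate \<alpha> R g"]
          by simp
      qed (simp add: bump_eq_0)
    qed
    also have "\<dots> = measure lborel ?B" by simp
    also have "\<dots> = unit_ball_vol (real n) * (2 * R powr (1 + \<alpha>)) ^ n"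
      unfolding n_def by (rule content_cball) simp
    also have "\<dots> = c * (R powr ((1 + \<alpha>) * real n / 2))\<^sup>2"
    proof -
      have sq: "(R powr (e / 2))\<^sup>2 = R powr e" for e
        by (simp add: power2_eq_square flip: powr_add)
      have "(R powr (1 + \<alpha>)) ^ n = R powr ((1 + \<alpha>) * real n)"
        using R powr_realpow[of "R powr (1 + \<alpha>)" n] by (simp add: powr_powr)
      also have "\<dots> = (R powr ((1 + \<alpha>) * real n / 2))\<^sup>2"
        by (rule sq[symmetric])
      finally show ?thesis by (simp add: c_def power_mult_distrib)
    qed
    finally have "L2_norm ?\<phi> \<le> sqrt (c * (R powr ((1 + \<alpha>) * real n / 2))\<^sup>2)"
      unfolding L2_norm_def by (rule real_sqrt_le_mono)
    then show "L2_norm ?\<phi> \<le> sqrt c * R powr ((1 + \<alpha>) * real n / 2)"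
      by (simp add: real_sqrt_mult)
  qed
qed

section \<open>Contraction semigroups on square integrable functions\<close>

lemma Lp2_iff: "f \<in> Lp 2 \<longleftrightarrow> f \<in> borel_measurable lebesgue \<and> integrable lebesgue (\<lambda>g. (f g)\<^sup>2)"
proof -
  have "\<bar>x\<bar> powr 2 = x\<^sup>2" for x :: real
    by (cases "x = 0") (auto simp: powr_numeral)
  then show ?thesis by (simp add: Lp_def)
qed

lemma Lp2_measurable: "f \<in> Lp 2 \<Longrightarrow> f \<in> borel_measurable lebesgue"
  and Lp2_integrable_square: "f \<in> Lp 2 \<Longrightarrow> integrable lebesgue (\<lambda>g. (f g)\<^sup>2)"
  by (simp_all add: Lp2_iff)

lemma Lp2_mult_integrable:
  assumes "f \<in> Lp 2" "h \<in> Lp 2"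
  shows "integrable lebesgue (\<lambda>g. f g * h g)"
proof (rule Bochner_Integration.integrable_bound)
  show "integrable lebesgue (\<lambda>g. (f g)\<^sup>2 + (h g)\<^sup>2)"
    using assms by (intro Bochner_Integration.integrable_add Lp2_integrable_square)
  show "(\<lambda>g. f g * h g) \<in> borel_measurable lebesgue"
    using assms by (intro borel_measurable_times Lp2_measurable)
  show "AE g in lebesgue. norm (f g * h g) \<le> norm ((f g)\<^sup>2 + (h g)\<^sup>2)"
  proof (intro AE_I2)
    fix g
    have "2 * (\<bar>f g\<bar> * \<bar>h g\<bar>) \<le> (f g)\<^sup>2 + (h g)\<^sup>2"
      using sum_squares_bound[of "\<bar>f g\<bar>" "\<bar>h g\<bar>"] by (simp add: mult.assoc)
    then have "\<bar>f g\<bar> * \<bar>h g\<bar> \<le> (f g)\<^sup>2 + (h g)\<^sup>2"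
      using mult_nonneg_nonneg[of "\<bar>f g\<bar>" "\<bar>h g\<bar>"] by linarith
    then show "norm (f g * h g) \<le> norm ((f g)\<^sup>2 + (h g)\<^sup>2)"
      by (simp add: abs_mult)
  qed
qed

lemma Lp2_lincomb:
  assumes "f \<in> Lp 2" "h \<in> Lp 2"
  shows "(\<lambda>g. a * f g + b * h g) \<in> Lp 2"
proof -
  have "integrable lebesgue (\<lambda>g. a\<^sup>2 * (f g)\<^sup>2 + b\<^sup>2 * (h g)\<^sup>2 + 2 * a * b * (f g * h g))"
    using assms by (intro Bochner_Integration.integrable_add integrable_mult_right
        Lp2_integrable_square Lp2_mult_integrable)
  also have "(\<lambda>g. a\<^sup>2 * (f g)\<^sup>2 + b\<^sup>2 * (h g)\<^sup>2 + 2 * a * b * (f g * h g)) = (\<lambda>g. (a * f g + b * h g)\<^sup>2)"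
    by (intro ext) (simp add: power2_eq_square algebra_simps)
  finally show ?thesis
    using assms by (auto simp: Lp2_iff intro!: borel_measurable_add borel_measurable_times)
qed

lemma L2_norm_nonneg: "L2_norm f \<ge> 0"
  by (auto simp: L2_norm_def L2_inner_def intro!: integral_nonneg_AE)

lemma L2_norm_square: "(L2_norm f)\<^sup>2 = (LINT g|lebesgue. (f g)\<^sup>2)"
  by (auto simp: L2_norm_def L2_inner_def power2_eq_square intro!: integral_nonneg_AE)

lemma L2_inner_lincomb_right:
  assumes "f \<in> Lp 2" "h1 \<in> Lp 2" "h2 \<in> Lp 2"
  shows "L2_inner f (\<lambda>g. a * h1 g + b * h2 g) = a * L2_inner f h1 + b * L2_inner f h2"
proof -
  have "L2_inner f (\<lambda>g. a * h1 g + b * h2 g)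
      = (LINT g|lebesgue. a * (f g * h1 g) + b * (f g * h2 g))"
    by (simp add: L2_inner_def algebra_simps)
  also have "\<dots> = a * L2_inner f h1 + b * L2_inner f h2"
    using assms by (subst Bochner_Integration.integral_add) (auto simp: L2_inner_def Lp2_mult_integrable)
  finally show ?thesis .
qed

lemma L2_inner_cong_AE:
  assumes "f \<in> Lp 2" "h1 \<in> Lp 2" "h2 \<in> Lp 2" "AE g in lebesgue. h1 g = h2 g"
  shows "L2_inner f h1 = L2_inner f h2"
  unfolding L2_inner_def
  by (rule integral_cong_AE) (use assms Lp2_measurable in \<open>auto intro!: borel_measurable_times\<close>)

lemma L2_inner_mono:
  assumes "f \<in> Lp 2" "h1 \<in> Lp 2" "h2 \<in> Lp 2"
    and "\<And>g. f g \<ge> 0" "AE g in lebesgue. h1 g \<le> h2 g"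
  shows "L2_inner f h1 \<le> L2_inner f h2"
  unfolding L2_inner_def
  by (intro integral_mono_AE Lp2_mult_integrable assms)
     (use assms(5) in eventually_elim, simp add: mult_left_mono assms(4))

text \<open>The quadratic form \<open>(x, y) \<mapsto> \<parallel>x f + y h\<parallel>\<^sup>2\<close> is non-negative.\<close>
lemma L2_Cauchy_Schwarz:
  assumes "f \<in> Lp 2" "h \<in> Lp 2"
  shows "\<bar>L2_inner f h\<bar> \<le> L2_norm f * L2_norm h"
proof -
  have "0 \<le> (LINT g|lebesgue. (x * f g + y * h g)\<^sup>2)" for x y :: real
    by (intro integral_nonneg_AE) auto
  moreover have "(LINT g|lebesgue. (x * f g + y * h g)\<^sup>2)
     = x\<^sup>2 * (L2_norm f)\<^sup>2 + 2 * x * y * L2_inner f h + y\<^sup>2 * (L2_norm h)\<^sup>2" for x y :: real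
  proof -
    have "(LINT g|lebesgue. (x * f g + y * h g)\<^sup>2) = 
      (LINT g|lebesgue. x\<^sup>2 * (f g)\<^sup>2 + 2 * x * y * (f g * h g) + y\<^sup>2 * (h g)\<^sup>2)"
      by (rule Bochner_Integration.integral_cong) (auto simp: power2_eq_square algebra_simps)
    also have "\<dots> = x\<^sup>2 * (L2_norm f)\<^sup>2 + 2 * x * y * L2_inner f h + y\<^sup>2 * (L2_norm h)\<^sup>2"
      using assms Lp2_integrable_square[of f] Lp2_integrable_square[of h] Lp2_mult_integrable[of f h]
      by (simp add: L2_norm_square L2_inner_def)
    finally show ?thesis .
  qed
  ultimately have q: "0 \<le> x\<^sup>2 * (L2_norm f)\<^sup>2 + 2 * x * y * L2_inner f h + y\<^sup>2 * (L2_norm h)\<^sup>2" for x y :: real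
    by simp
  let ?a = "L2_norm f" and ?b = "L2_norm h" and ?c = "L2_inner f h"
  have "?c\<^sup>2 \<le> (?a * ?b)\<^sup>2"
  proof (cases "?b = 0")
    case True
    have "0 \<le> ?a\<^sup>2 + 2 * y * ?c" for y using q[of 1 y] True by simp
    from this[of "- (?a\<^sup>2 + 1) / (2 * ?c)"] have "?c = 0"
      by (cases "?c = 0") (auto simp: field_simps)
    then show ?thesis by simp
  next
    case False
    have "0 \<le> (?b\<^sup>2)\<^sup>2 * ?a\<^sup>2 + 2 * ?b\<^sup>2 * (- ?c) * ?c + (- ?c)\<^sup>2 * ?b\<^sup>2"
      using q[of "?b\<^sup>2" "- ?c"] .
    also have "\<dots> = ?b\<^sup>2 * ((?a * ?b)\<^sup>2 - ?c\<^sup>2)"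
      by (simp add: power2_eq_square algebra_simps)
    finally show ?thesis using False by (simp add: zero_le_mult_iff)
  qed
  then show ?thesis
    using abs_le_square_iff[of ?c "?a * ?b"] L2_norm_nonneg[of f] L2_norm_nonneg[of h] by simp
qed

text \<open>An integrated form of \<open>d/ds \<langle>f, T s \<phi>\<rangle> = \<langle>f, T s w\<rangle>\<close>. The interval \<open>[0, s]\<close> is cut into \<open>N\<close> steps of
  length \<open>h\<close>. On each step \<open>T h \<phi> = \<phi> + h * (w + r)\<close> with the same remainder \<open>r\<close>, which is small in
  \<open>L\<^sup>2\<close> because \<open>w\<close> is the value of the generator at \<open>\<phi>\<close>; applying \<open>T (j * h)\<close> does not increase it.
  Summing the steps avoids differentiating and integrating functions with values in \<open>L\<^sup>2\<close>.\<close>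
lemma semigroup_duhamel_bound:
  assumes T: "contraction_semigroup T"
    and gen: "(\<phi>, w) \<in> generator T"
    and f: "f \<in> Lp 2"
    and t: "t \<ge> 0"
    and B: "\<And>s. 0 \<le> s \<Longrightarrow> s \<le> t \<Longrightarrow> L2_inner f (T s w) \<le> B"
    and s: "0 \<le> s" "s \<le> t"
  shows "L2_inner f (T s \<phi>) \<le> L2_inner f \<phi> + s * B"
proof -
  have \<phi>: "\<phi> \<in> Lp 2" and w: "w \<in> Lp 2"
    and lim: "((\<lambda>h. L2_norm (\<lambda>g. (T h \<phi> g - \<phi> g) / h - w g)) \<longlongrightarrow> 0) (at_right 0)"
    using gen by (auto simp: generator_def)
  have TL: "T r v \<in> Lp 2" if "r \<ge> 0" "v \<in> Lp 2" for r v
    using T that by (auto simp: contraction_semigroup_def)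
  have TN: "L2_norm (T r v) \<le> L2_norm v" if "r \<ge> 0" "v \<in> Lp 2" for r v
    using T that by (auto simp: contraction_semigroup_def)
  have Tlin: "L2_inner f (T r (\<lambda>g. a * v1 g + b * v2 g)) = a * L2_inner f (T r v1) + b * L2_inner f (T r v2)"
    if "r \<ge> 0" "v1 \<in> Lp 2" "v2 \<in> Lp 2" for r a b v1 v2
  proof -
    have "AE g in lebesgue. T r (\<lambda>g. a * v1 g + b * v2 g) g = a * T r v1 g + b * T r v2 g"
      using T that by (auto simp: contraction_semigroup_def)
    then have "L2_inner f (T r (\<lambda>g. a * v1 g + b * v2 g)) = L2_inner f (\<lambda>g. a * T r v1 g + b * T r v2 g)"
      using that f by (intro L2_inner_cong_AE TL Lp2_lincomb) auto
    then show ?thesis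
      using L2_inner_lincomb_right[OF f TL TL, OF that(1,2) that(1,3)] by simp
  qed
  have Tadd: "L2_inner f (T (r + h) v) = L2_inner f (T r (T h v))" if "r \<ge> 0" "h \<ge> 0" "v \<in> Lp 2" for r h v
    using T that f by (intro L2_inner_cong_AE TL) (auto simp: contraction_semigroup_def)
  have T0: "L2_inner f (T 0 \<phi>) = L2_inner f \<phi>"
    using T \<phi> f by (intro L2_inner_cong_AE TL) (auto simp: contraction_semigroup_def)
  show ?thesis
  proof (cases "s = 0")
    case True
    then show ?thesis using T0 by simp
  next
    case False
    with s have s0: "s > 0" by simp
    show ?thesis
    proof (rule field_le_epsilon)
      fix e :: real assume e: "e > 0"
      \<comment> \<open>The remainder contributes at most \<open>s * L2_norm f * \<epsilon>\<close> in total; the summand one keeps the denominator positive.\<close>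
      define \<epsilon> where "\<epsilon> = e / (s * (L2_norm f + 1))"
      have nf: "L2_norm f + 1 > 0" using L2_norm_nonneg[of f] by simp
      have \<epsilon>: "\<epsilon> > 0" using e s0 nf by (simp add: \<epsilon>_def)
      have "eventually (\<lambda>h. L2_norm (\<lambda>g. (T h \<phi> g - \<phi> g) / h - w g) < \<epsilon>) (at_right 0)"
        using order_tendstoD(2)[OF lim \<epsilon>] .
      then obtain h0 where h0: "h0 > 0"
        "\<And>h. 0 < h \<Longrightarrow> h < h0 \<Longrightarrow> L2_norm (\<lambda>g. (T h \<phi> g - \<phi> g) / h - w g) < \<epsilon>"
        unfolding eventually_at_right_field by auto
      obtain N :: nat where N: "s / h0 < real N" using reals_Archimedean2 by blast
      have Npos: "N > 0" using N s0 h0 by (metis divide_pos_pos of_nat_0_less_iff order.strict_trans)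
      define h where "h = s / real N"
      have h: "h > 0" "h < h0" using N Npos s0 h0 by (auto simp: h_def field_simps)
      define r where "r = (\<lambda>g. (T h \<phi> g - \<phi> g) / h - w g)"
      have rn: "L2_norm r < \<epsilon>" using h0(2)[OF h] by (simp add: r_def)
      have r: "r \<in> Lp 2"
      proof -
        have "(\<lambda>g. 1 * (1 / h * T h \<phi> g + (- 1 / h) * \<phi> g) + (-1) * w g) \<in> Lp 2"
          using h by (intro Lp2_lincomb TL \<phi> w) auto
        then show ?thesis by (simp add: r_def diff_divide_distrib)
      qed
      have Th: "T h \<phi> = (\<lambda>g. 1 * \<phi> g + h * (1 * w g + 1 * r g))"
        using h by (intro ext) (simp add: r_def)
      have "L2_inner f (T (real j * h) \<phi>) \<le> L2_inner f \<phi> + real j * (h * (B + L2_norm f * \<epsilon>))"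
        if "j \<le> N" for j
        using that
      proof (induction j)
        case 0
        then show ?case using T0 by simp
      next
        case (Suc j)
        have jh: "real j * h \<ge> 0" using h by simp
        have jt: "real j * h \<le> t"
        proof -
          have "real j * h \<le> real N * h" using Suc.prems h by (intro mult_right_mono) auto
          also have "\<dots> = s" using Npos by (simp add: h_def)
          finally show ?thesis using s by simp
        qed
        have "L2_inner f (T (real (Suc j) * h) \<phi>) = L2_inner f (T (real j * h + h) \<phi>)"
          by (simp add: algebra_simps)
        also have "\<dots> = L2_inner f (T (real j * h) (T h \<phi>))"
          using jh h \<phi> by (intro Tadd) auto
        also have "\<dots> = 1 * L2_inner f (T (real j * h) \<phi>) + h * L2_inner f (T (real j * h) (\<lambda>g. 1 * w g + 1 * r g))"
          unfolding Th by (intro Tlin jh \<phi> Lp2_lincomb w r)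
        also have "L2_inner f (T (real j * h) (\<lambda>g. 1 * w g + 1 * r g))
            = 1 * L2_inner f (T (real j * h) w) + 1 * L2_inner f (T (real j * h) r)"
          by (intro Tlin jh w r)
        also have "1 * L2_inner f (T (real j * h) \<phi>) + h * (1 * L2_inner f (T (real j * h) w) + 1 * L2_inner f (T (real j * h) r))
          \<le> 1 * (L2_inner f \<phi> + real j * (h * (B + L2_norm f * \<epsilon>))) + h * (1 * B + 1 * (L2_norm f * \<epsilon>))"
        proof (intro add_mono mult_left_mono)
          show "L2_inner f (T (real j * h) \<phi>) \<le> L2_inner f \<phi> + real j * (h * (B + L2_norm f * \<epsilon>))"
            using Suc by simp
          show "L2_inner f (T (real j * h) w) \<le> B" by (intro B jh jt)
          have "L2_inner f (T (real j * h) r) \<le> L2_norm f * L2_norm (T (real j * h) r)"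
            using L2_Cauchy_Schwarz[OF f TL[OF jh r]] by simp
          also have "\<dots> \<le> L2_norm f * \<epsilon>"
            using TN[OF jh r] rn by (intro mult_left_mono L2_norm_nonneg) auto
          finally show "L2_inner f (T (real j * h) r) \<le> L2_norm f * \<epsilon>" .
        qed (use h in auto)
        also have "\<dots> = L2_inner f \<phi> + real (Suc j) * (h * (B + L2_norm f * \<epsilon>))"
          by (simp add: algebra_simps)
        finally show ?case .
      qed
      from this[of N] have "L2_inner f (T s \<phi>) \<le> L2_inner f \<phi> + s * (B + L2_norm f * \<epsilon>)"
        using Npos by (simp add: h_def)
      also have "\<dots> = L2_inner f \<phi> + s * B + e * (L2_norm f / (L2_norm f + 1))"
      proof -
        have "s * (L2_norm f * \<epsilon>) = e * (L2_norm f / (L2_norm f + 1))"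
          using s0 by (simp add: \<epsilon>_def)
        then show ?thesis by (simp add: distrib_left)
      qed
      also have "\<dots> \<le> L2_inner f \<phi> + s * B + e"
        using e nf by (simp add: field_simps)
      finally show "L2_inner f (T s \<phi>) \<le> L2_inner f \<phi> + s * B + e" .
    qed
  qed
qed

section \<open>The mass of the heat kernel\<close>

lemma indicator_Lp2:
  assumes "S \<in> lmeasurable"
  shows "(indicator S :: 'a::euclidean_space \<Rightarrow> real) \<in> Lp 2"
proof -
  have "(\<lambda>g. (indicator S g :: real)\<^sup>2) = indicator S"
    by (auto simp: indicator_def)
  then show ?thesis using assms by (auto simp: Lp2_iff fmeasurable_def)
qed

text \<open>Going from scale \<open>2 * R\<close> to \<open>R\<close> costs a factor \<open>\<theta>\<close>. Applying \<open>step\<close> \<open>k\<close> times and then \<open>crude\<close> at scale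
  \<open>2\<^sup>k R\<close> leaves the geometric series \<open>a (1 + \<theta> + \<theta>\<^sup>2 + \<dots>) \<le> 2 a\<close> and the error
  \<open>(\<theta> * 2 powr d)\<^sup>k * W * R powr d\<close>, which vanishes as \<open>k\<close> grows.\<close>
lemma mass_iteration:
  fixes m :: "real \<Rightarrow> real \<Rightarrow> real" and \<theta> d a W t R0 :: real
  assumes R0: "R0 > 0" and a: "a \<ge> 0" and W: "W \<ge> 0"
    and \<theta>: "0 \<le> \<theta>" "\<theta> \<le> 1 / 2" "\<theta> * 2 powr d \<le> 1 / 2"
    and crude: "\<And>R s. R \<ge> R0 \<Longrightarrow> 0 \<le> s \<Longrightarrow> s \<le> t \<Longrightarrow> m R s \<le> W * R powr d"
    and step: "\<And>R s B. R \<ge> R0 \<Longrightarrow> 0 \<le> s \<Longrightarrow> s \<le> t \<Longrightarrow> B \<ge> 0 \<Longrightarrow>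
        (\<And>r. 0 \<le> r \<Longrightarrow> r \<le> t \<Longrightarrow> m (2 * R) r \<le> B) \<Longrightarrow> m R s \<le> a + \<theta> * B"
    and R: "R \<ge> R0" and s: "0 \<le> s" "s \<le> t"
  shows "m R s \<le> 2 * a"
proof -
  have iter: "m R s \<le> 2 * a * (1 - (1 / 2) ^ k) + (1 / 2) ^ k * (W * R powr d)"
    if "R \<ge> R0" "0 \<le> s" "s \<le> t" for k R s
    using that
  proof (induction k arbitrary: R s)
    case 0
    then show ?case using crude by simp
  next
    case (Suc k)
    define q where "q = (1 / 2 :: real) ^ k"
    have q: "0 \<le> q" "q \<le> 1" by (auto simp: q_def power_le_one)
    define B where "B = 2 * a * (1 - q) + q * (W * (2 * R) powr d)"
    have B: "B \<ge> 0" using q a W by (simp add: B_def)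
    have "m R s \<le> a + \<theta> * B"
      using Suc R0 B by (intro step) (auto simp: B_def q_def)
    also have "\<theta> * B = \<theta> * (2 * a * (1 - q)) + (\<theta> * 2 powr d) * (q * (W * R powr d))"
      using Suc.prems R0 by (simp add: B_def powr_mult algebra_simps)
    also have "\<dots> \<le> 1 / 2 * (2 * a * (1 - q)) + 1 / 2 * (q * (W * R powr d))"
      using q a W by (intro add_mono mult_right_mono \<theta>) auto
    finally show ?case by (simp add: q_def algebra_simps)
  qed
  have "(\<lambda>k. 2 * a * (1 - (1 / 2) ^ k) + (1 / 2) ^ k * (W * R powr d)) \<longlonglongrightarrow> 2 * a * (1 - 0) + 0 * (W * R powr d)"
    by (intro tendsto_intros LIMSEQ_power_zero) auto
  then show ?thesis
    using LIMSEQ_le_const[of _ "2 * a" "m R s"] iter[OF R s] by simp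
qed

text \<open>For an indicator function \<open>f\<close> the pairing \<open>\<langle>f, T s (\<phi> R)\<rangle>\<close> starts below \<open>\<integral>f\<close> and grows only by what the
  generator feeds in. By positivity this is controlled by \<open>\<langle>f, T r (\<phi> (2 * R))\<rangle>\<close> with a factor that is
  small for large \<open>R\<close>, so that \<open>mass_iteration\<close> applies and \<open>\<langle>f, T t (\<phi> R)\<rangle> \<le> 2 * \<integral>f\<close>. The threshold
  for \<open>R\<close> depends on \<open>t\<close> but not on \<open>f\<close>, and therefore the bound is pointwise.\<close>
lemma semigroup_mass_bound:
  fixes T :: "real \<Rightarrow> ('a::euclidean_space \<Rightarrow> real) \<Rightarrow> 'a \<Rightarrow> real"
  assumes T: "contraction_semigroup T"
    and pos: "\<And>s v. s \<ge> 0 \<Longrightarrow> v \<in> Lp 2 \<Longrightarrow> (\<And>g. v g \<ge> 0) \<Longrightarrow> AE g in lebesgue. T s v g \<ge> 0"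
    and gen: "\<And>R. R > 0 \<Longrightarrow> (\<phi> R, w R) \<in> generator T"
    and w: "\<And>R g. R > 0 \<Longrightarrow> w R g \<le> C / R\<^sup>2 * \<phi> (2 * R) g"
    and \<phi>: "\<And>R g. 0 \<le> \<phi> R g" "\<And>R g. \<phi> R g \<le> 1"
    and crude: "\<And>R. R \<ge> 1 \<Longrightarrow> L2_norm (\<phi> R) \<le> W * R powr d"
    and C: "C \<ge> 0" and t: "t \<ge> 0"
  shows "\<exists>R0>0. \<forall>R\<ge>R0. AE g in lebesgue. T t (\<phi> R) g \<le> 2"
proof -
  have \<phi>L: "\<phi> R \<in> Lp 2" and wL: "w R \<in> Lp 2" if "R > 0" for R
    using gen[OF that] by (auto simp: generator_def)
  have TL: "T r v \<in> Lp 2" if "r \<ge> 0" "v \<in> Lp 2" for r v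
    using T that by (auto simp: contraction_semigroup_def)
  have TN: "L2_norm (T r v) \<le> L2_norm v" if "r \<ge> 0" "v \<in> Lp 2" for r v
    using T that by (auto simp: contraction_semigroup_def)
  have Tlin: "AE g in lebesgue. T r (\<lambda>g. a * v1 g + b * v2 g) g = a * T r v1 g + b * T r v2 g"
    if "r \<ge> 0" "v1 \<in> Lp 2" "v2 \<in> Lp 2" for r a b v1 v2
    using T that by (auto simp: contraction_semigroup_def)
  \<comment> \<open>The largest factor that the iteration admits; \<open>R0\<close> is chosen so that \<open>t * C / R\<^sup>2\<close> stays below it.\<close>
  define \<theta> where "\<theta> = min (1 / 2) (1 / (2 * 2 powr d))"
  have \<theta>: "0 < \<theta>" "\<theta> \<le> 1 / 2" "\<theta> * 2 powr d \<le> 1 / 2"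
  proof -
    have "\<theta> * 2 powr d \<le> 1 / (2 * 2 powr d) * 2 powr d"
      by (intro mult_right_mono) (auto simp: \<theta>_def)
    then show "\<theta> * 2 powr d \<le> 1 / 2" by simp
  qed (auto simp: \<theta>_def)
  define R0 where "R0 = max 1 (t * C / \<theta>)"
  have R01: "R0 \<ge> 1" by (simp add: R0_def)
  have small: "t * (C / R\<^sup>2) \<le> \<theta>" if "R \<ge> R0" for R
  proof -
    have "t * C / \<theta> \<le> R0" by (simp add: R0_def)
    then have "t * C \<le> \<theta> * R0" using \<theta> by (simp add: pos_divide_le_eq mult.commute)
    also have "\<dots> \<le> \<theta> * R\<^sup>2"
    proof (intro mult_left_mono)
      have "R0 * 1 \<le> R * R" using that R01 by (intro mult_mono) auto
      then show "R0 \<le> R\<^sup>2" by (simp add: power2_eq_square)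
    qed (use \<theta> in auto)
    finally show ?thesis using that R01 by (simp add: pos_divide_le_eq)
  qed
  have main: "L2_inner f (T t (\<phi> R)) \<le> 2 * measure lebesgue S"
    if R: "R \<ge> R0" and S: "S \<in> lmeasurable" and f_def: "f = indicator S" for R S and f :: "'a \<Rightarrow> real"
  proof (rule mass_iteration[where m = "\<lambda>R s. L2_inner f (T s (\<phi> R))" and t = t and \<theta> = \<theta> and d = d
        and W = "L2_norm f * W" and ?R0.0 = R0])
    have f: "f \<in> Lp 2" unfolding f_def by (rule indicator_Lp2[OF S])
    have f0: "f g \<ge> 0" for g by (simp add: f_def)
    show "0 < R0" using R01 by simp
    show "0 \<le> L2_norm f * W"
      using crude[of 1] L2_norm_nonneg[of "\<phi> 1"] L2_norm_nonneg[of f] by simp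
    show "0 \<le> \<theta>" using \<theta> by simp
    show "L2_inner f (T s (\<phi> R)) \<le> L2_norm f * W * R powr d" if "R \<ge> R0" "0 \<le> s" "s \<le> t" for R s
    proof -
      have "L2_inner f (T s (\<phi> R)) \<le> L2_norm f * L2_norm (T s (\<phi> R))"
        using L2_Cauchy_Schwarz[OF f TL[of s "\<phi> R"]] \<phi>L[of R] that R01 by auto
      also have "\<dots> \<le> L2_norm f * (W * R powr d)"
        using TN[of s "\<phi> R"] \<phi>L[of R] crude[of R] that R01
        by (intro mult_left_mono L2_norm_nonneg) auto
      finally show ?thesis by (simp add: mult.assoc)
    qed
    show "L2_inner f (T s (\<phi> R)) \<le> measure lebesgue S + \<theta> * B"
      if R: "R \<ge> R0" and s: "0 \<le> s" "s \<le> t" and B: "B \<ge> 0"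
        and b: "\<And>r. 0 \<le> r \<Longrightarrow> r \<le> t \<Longrightarrow> L2_inner f (T r (\<phi> (2 * R))) \<le> B" for R s B
    proof -
      have R': "R > 0" using R R01 by simp
      define c where "c = C / R\<^sup>2"
      have c: "c \<ge> 0" using C by (simp add: c_def)
      have "L2_inner f (T r (w R)) \<le> c * B" if r: "0 \<le> r" "r \<le> t" for r
      proof -
        have "AE g in lebesgue. T r (\<lambda>g. c * \<phi> (2 * R) g + (-1) * w R g) g \<ge> 0"
          using w[OF R'] R' r by (intro pos Lp2_lincomb \<phi>L wL) (auto simp: c_def)
        moreover have "AE g in lebesgue. T r (\<lambda>g. c * \<phi> (2 * R) g + (-1) * w R g) g
            = c * T r (\<phi> (2 * R)) g + (-1) * T r (w R) g"
          using r R' by (intro Tlin \<phi>L wL) auto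
        ultimately have "AE g in lebesgue. T r (w R) g \<le> c * T r (\<phi> (2 * R)) g + 0 * T r (w R) g"
          by eventually_elim simp
        then have "L2_inner f (T r (w R)) \<le> L2_inner f (\<lambda>g. c * T r (\<phi> (2 * R)) g + 0 * T r (w R) g)"
          using R' r by (intro L2_inner_mono f f0 TL wL Lp2_lincomb \<phi>L) auto
        also have "\<dots> = c * L2_inner f (T r (\<phi> (2 * R))) + 0 * L2_inner f (T r (w R))"
          using R' r by (intro L2_inner_lincomb_right f TL wL \<phi>L) auto
        also have "\<dots> \<le> c * B"
          using b[OF r] c by (simp add: mult_left_mono)
        finally show ?thesis .
      qed
      from semigroup_duhamel_bound[OF T gen[OF R'] f t this s]
      have "L2_inner f (T s (\<phi> R)) \<le> L2_inner f (\<phi> R) + s * (c * B)" .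
      also have "L2_inner f (\<phi> R) \<le> measure lebesgue S"
      proof -
        have "L2_inner f (\<phi> R) \<le> (LINT g|lebesgue. indicator S g)"
          unfolding L2_inner_def
        proof (intro integral_mono Lp2_mult_integrable f \<phi>L R')
          show "f g * \<phi> R g \<le> indicator S g" for g
            using \<phi>(2)[of R g] by (simp add: f_def indicator_def)
        qed (use S in \<open>auto simp: fmeasurable_def\<close>)
        then show ?thesis by simp
      qed
      also have "s * (c * B) \<le> \<theta> * B"
      proof -
        have "s * c \<le> t * c" using s c by (intro mult_right_mono) auto
        also have "\<dots> \<le> \<theta>" using small[OF R] by (simp add: c_def)
        finally show ?thesis using B by (simp add: mult.assoc[symmetric] mult_right_mono)
      qed
      finally show ?thesis by simp
    qed
  qed (use \<theta> t R in auto)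
  have "AE g in lebesgue. T t (\<phi> R) g \<le> 2" if R: "R \<ge> R0" for R
  proof -
    define v where "v = T t (\<phi> R)"
    have v: "v \<in> Lp 2" using R R01 t unfolding v_def by (intro TL \<phi>L) auto
    have vm[measurable]: "v \<in> borel_measurable lebesgue" by (rule Lp2_measurable[OF v])
    have "AE g in lebesgue. g \<in> cball 0 (real n) \<longrightarrow> v g \<le> 2" for n
    proof -
      \<comment> \<open>Testing against the indicator of the part of the bad set in a ball shows that this part is null.\<close>
      define S where "S = cball 0 (real n) \<inter> {g \<in> space lebesgue. v g > 2}"
      have "{g \<in> space lebesgue. v g > 2} \<in> sets lebesgue" by measurable
      then have S: "S \<in> lmeasurable"
        unfolding S_def by (intro fmeasurable_Int_fmeasurable lmeasurable_cball)
      define f :: "'a \<Rightarrow> real" where "f = indicator S"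
      have f: "f \<in> Lp 2" unfolding f_def by (rule indicator_Lp2[OF S])
      have int: "integrable lebesgue (\<lambda>g. f g * v g)" "integrable lebesgue f"
        using Lp2_mult_integrable[OF f v] S by (auto simp: f_def fmeasurable_def)
      have "(LINT g|lebesgue. f g * v g - 2 * f g) = L2_inner f v - 2 * measure lebesgue S"
        using int by (simp add: L2_inner_def f_def)
      also have "\<dots> \<le> 0" using main[OF R S f_def] by (simp add: v_def)
      finally have le: "(LINT g|lebesgue. f g * v g - 2 * f g) \<le> 0" .
      have nn: "f g * v g - 2 * f g \<ge> 0" for g
        by (auto simp: f_def S_def indicator_def)
      have "(LINT g|lebesgue. f g * v g - 2 * f g) = 0"
        using le nn by (intro antisym integral_nonneg_AE) auto
      then have "AE g in lebesgue. f g * v g - 2 * f g = 0"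
        using int nn by (subst (asm) integral_nonneg_eq_0_iff_AE) auto
      then show ?thesis
        by eventually_elim (auto simp: f_def S_def indicator_def split: if_splits)
    qed
    then have "AE g in lebesgue. \<forall>n. g \<in> cball 0 (real n) \<longrightarrow> v g \<le> 2"
      unfolding AE_all_countable by blast
    then show ?thesis
      unfolding v_def[symmetric]
    proof eventually_elim
      fix g :: 'a assume a: "\<forall>n. g \<in> cball 0 (real n) \<longrightarrow> v g \<le> 2"
      obtain n :: nat where "norm g \<le> real n" using real_arch_simple by blast
      then show "v g \<le> 2" using a by auto
    qed
  qed
  then show ?thesis using R01 by (intro exI[of _ R0]) auto
qed

lemma grushin_heat_kernel_measurable:
  assumes "is_grushin_heat_kernel \<alpha> K" "t > 0"
  shows "(\<lambda>(g, g'). K t g g') \<in> borel_measurable borel"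
proof -
  have m: "(\<lambda>(t, g, g'). K t g g') \<in> borel_measurable (restrict_space borel ({0<..} \<times> UNIV))"
    using assms by (simp add: is_grushin_heat_kernel_def)
  have "(\<lambda>z. (t, z)) \<in> borel_measurable borel"
    by (intro borel_measurable_continuous_onI continuous_intros)
  then have "(\<lambda>z. (t, z)) \<in> measurable borel (restrict_space borel ({0<..} \<times> UNIV))"
    using assms(2) by (intro measurable_restrict_space2) auto
  from measurable_compose[OF this m] show ?thesis by (simp add: case_prod_beta)
qed

text \<open>The bumps \<open>\<phi> R\<close> tend pointwise to the value \<open>exp (- 1)\<close> of the bump at the origin, which turns the
  bound two for \<open>T t (\<phi> R)\<close> into \<open>2 * exp 1\<close>. What matters is that this constant does
  not depend on \<open>t\<close>.\<close>
lemma grushin_heat_kernel_mass: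
  fixes K :: "real \<Rightarrow> ('m::finite, 'k::finite) grushin_space \<Rightarrow> ('m, 'k) grushin_space \<Rightarrow> real"
  assumes \<alpha>: "\<alpha> \<ge> 0" and K: "is_grushin_heat_kernel \<alpha> K" and t: "t > 0"
  shows "AE g in lebesgue. (\<integral>\<^sup>+ g'. ennreal (K t g g') \<partial>lebesgue) \<le> ennreal (2 * exp 1)"
proof -
  from K obtain A T where A: "is_grushin_laplacian \<alpha> A" and T: "exp_semigroup A T"
    and rep: "\<And>s f. s > 0 \<Longrightarrow> f \<in> Lp 2 \<Longrightarrow> AE g in lebesgue.
           integrable lebesgue (\<lambda>g'. K s g g' * f g') \<and> T s f g = (LINT g'|lebesgue. K s g g' * f g')"
    unfolding is_grushin_heat_kernel_def by blast
  have Knn: "K s g g' \<ge> 0" if "s > 0" for s g g'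
    using K that unfolding is_grushin_heat_kernel_def by blast
  have cs: "contraction_semigroup T" using T by (simp add: exp_semigroup_def)
  define \<phi> :: "real \<Rightarrow> ('m, 'k) grushin_space \<Rightarrow> real" where "\<phi> R = (\<lambda>g. bump (dilate \<alpha> R g))" for R
  define w where "w R = (\<lambda>g. - grushin_op \<alpha> (\<phi> R) g)" for R
  have gen: "(\<phi> R, w R) \<in> generator T" if "R > 0" for R
  proof -
    have "(\<phi> R, grushin_op \<alpha> (\<phi> R)) \<in> A"
      using A bump_dilate_test_function[OF that, of \<alpha>] unfolding is_grushin_laplacian_def \<phi>_def by blast
    then show ?thesis using T by (auto simp: exp_semigroup_def w_def)
  qed
  obtain C where C: "C \<ge> 0" and L: "\<And>R g. R > 0 \<Longrightarrow> \<bar>grushin_op \<alpha> (\<phi> R) g\<bar> \<le> C / R\<^sup>2 * \<phi> (2 * R) g"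
    using grushin_op_bump_bound[OF \<alpha>, where 'm = 'm and 'k = 'k] unfolding \<phi>_def by blast
  obtain W d where W: "\<And>R. R \<ge> 1 \<Longrightarrow> L2_norm (\<phi> R) \<le> W * R powr d"
    using L2_norm_bump_dilate[OF \<alpha>, where 'm = 'm and 'k = 'k] unfolding \<phi>_def by blast
  have pos: "AE g in lebesgue. T s v g \<ge> 0" if "s \<ge> 0" "v \<in> Lp 2" and v: "\<And>g. v g \<ge> 0" for s v
  proof (cases "s = 0")
    case True
    have "AE g in lebesgue. T 0 v g = v g"
      using cs that by (auto simp: contraction_semigroup_def)
    then show ?thesis unfolding True by eventually_elim (simp add: v)
  next
    case False
    with that have s: "s > 0" by simp
    show ?thesis
      using rep[OF s that(2)] by eventually_elim (simp add: Knn[OF s] v integral_nonneg_AE)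
  qed
  have wb: "w R g \<le> C / R\<^sup>2 * \<phi> (2 * R) g" if "R > 0" for R g
    using L[OF that, of g] by (simp add: w_def)
  have "\<exists>R0>0. \<forall>R\<ge>R0. AE g in lebesgue. T t (\<phi> R) g \<le> 2"
  proof (rule semigroup_mass_bound[OF cs pos gen wb _ _ W C, of t])
    show "0 \<le> \<phi> R g" "\<phi> R g \<le> 1" for R g
      by (simp_all add: \<phi>_def bump_nonneg bump_le_1)
    show "0 \<le> t" using t by simp
  qed
  then obtain R0 where R0: "R0 > 0" and le2: "\<And>R. R \<ge> R0 \<Longrightarrow> AE g in lebesgue. T t (\<phi> R) g \<le> 2"
    by blast
  define r where "r j = R0 + real j" for j
  have r: "r j \<ge> R0" "r j > 0" for j using R0 by (auto simp: r_def)
  have \<phi>L: "\<phi> (r j) \<in> Lp 2" for j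
    using gen[OF r(2)] by (auto simp: generator_def)
  have lim: "(\<lambda>j. \<phi> (r j) g) \<longlonglongrightarrow> exp (-1)" for g
  proof -
    have r_top: "filterlim r at_top sequentially"
      unfolding r_def by (intro filterlim_tendsto_add_at_top[OF tendsto_const] filterlim_real_sequentially)
    have "(\<lambda>j. r j powr (- (1 + \<alpha>))) \<longlonglongrightarrow> 0" "(\<lambda>j. r j powr (- 1)) \<longlonglongrightarrow> 0"
      using \<alpha> by (intro tendsto_neg_powr r_top; simp)+
    then have "(\<lambda>j. 1 / r j powr (1 + \<alpha>)) \<longlonglongrightarrow> 0" "(\<lambda>j. 1 / r j) \<longlonglongrightarrow> 0"
      unfolding powr_minus_divide using r(2) by (simp_all add: less_imp_le)
    then have "(\<lambda>j. dilate \<alpha> (r j) g) \<longlonglongrightarrow> (0 *\<^sub>R fst g, 0 *\<^sub>R snd g)"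
      unfolding dilate_def by (intro tendsto_intros)
    then have 0: "(\<lambda>j. dilate \<alpha> (r j) g) \<longlonglongrightarrow> 0" by (simp add: zero_prod_def)
    have "isCont (bump :: ('m, 'k) grushin_space \<Rightarrow> real) 0"
      using C_diff_bump[of 0, where 'a = "('m, 'k) grushin_space"]
      by (simp add: continuous_on_eq_continuous_at del: split_paired_All)
    from isCont_tendsto_compose[OF this 0] show ?thesis
      by (simp add: \<phi>_def bump_def flat_def)
  qed
  have "AE g in lebesgue. \<forall>j. T t (\<phi> (r j)) g \<le> 2 \<and>
      integrable lebesgue (\<lambda>g'. K t g g' * \<phi> (r j) g') \<and>
      T t (\<phi> (r j)) g = (LINT g'|lebesgue. K t g g' * \<phi> (r j) g')"
    unfolding AE_all_countable
  proof
    fix j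
    show "AE g in lebesgue. T t (\<phi> (r j)) g \<le> 2 \<and>
      integrable lebesgue (\<lambda>g'. K t g g' * \<phi> (r j) g') \<and>
      T t (\<phi> (r j)) g = (LINT g'|lebesgue. K t g g' * \<phi> (r j) g')"
      using le2[OF r(1)] rep[OF t \<phi>L] by eventually_elim auto
  qed
  then show ?thesis
  proof eventually_elim
    fix g
    assume a: "\<forall>j. T t (\<phi> (r j)) g \<le> 2 \<and>
      integrable lebesgue (\<lambda>g'. K t g g' * \<phi> (r j) g') \<and>
      T t (\<phi> (r j)) g = (LINT g'|lebesgue. K t g g' * \<phi> (r j) g')"
    have nn: "K t g g' * \<phi> (r j) g' \<ge> 0" for j g'
      using Knn[OF t] by (simp add: \<phi>_def bump_nonneg)
    have j: "(\<integral>\<^sup>+ g'. ennreal (K t g g' * \<phi> (r j) g') \<partial>lebesgue) \<le> 2" for j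
    proof -
      have "(\<integral>\<^sup>+ g'. ennreal (K t g g' * \<phi> (r j) g') \<partial>lebesgue)
          = ennreal (LINT g'|lebesgue. K t g g' * \<phi> (r j) g')"
        using a nn by (intro nn_integral_eq_integral) auto
      also have "\<dots> \<le> ennreal 2"
        using a by (intro ennreal_leI) metis
      finally show ?thesis by simp
    qed
    have "(\<integral>\<^sup>+ g'. ennreal (K t g g' * exp (-1)) \<partial>lebesgue)
        = (\<integral>\<^sup>+ g'. liminf (\<lambda>j. ennreal (K t g g' * \<phi> (r j) g')) \<partial>lebesgue)"
    proof (rule nn_integral_cong)
      fix g'
      have "(\<lambda>j. ennreal (K t g g' * \<phi> (r j) g')) \<longlonglongrightarrow> ennreal (K t g g' * exp (-1))"
        by (intro tendsto_intros lim)
      then show "ennreal (K t g g' * exp (-1)) = liminf (\<lambda>j. ennreal (K t g g' * \<phi> (r j) g'))"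
        by (subst lim_imp_Liminf) auto
    qed
    also have "\<dots> \<le> liminf (\<lambda>j. \<integral>\<^sup>+ g'. ennreal (K t g g' * \<phi> (r j) g') \<partial>lebesgue)"
      using a by (intro nn_integral_liminf) (auto intro!: measurable_compose[OF _ measurable_ennreal])
    also have "\<dots> \<le> 2"
      using Liminf_mono[of "\<lambda>j. \<integral>\<^sup>+ g'. ennreal (K t g g' * \<phi> (r j) g') \<partial>lebesgue" "\<lambda>_. 2" sequentially] j
      by (simp add: Liminf_const)
    finally have *: "(\<integral>\<^sup>+ g'. ennreal (K t g g' * exp (-1)) \<partial>lebesgue) \<le> 2" .
    have Km: "(\<lambda>g'. K t g g') \<in> borel_measurable borel"
    proof -
      have "(\<lambda>g'. (g, g')) \<in> borel_measurable borel"
        by (intro borel_measurable_continuous_onI continuous_intros)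
      from measurable_compose[OF this grushin_heat_kernel_measurable[OF K t]]
      show ?thesis by simp
    qed
    have "(\<integral>\<^sup>+ g'. ennreal (K t g g') \<partial>lebesgue)
      = (\<integral>\<^sup>+ g'. ennreal (exp 1) * ennreal (K t g g' * exp (-1)) \<partial>lborel)"
      unfolding nn_integral_completion
      by (intro nn_integral_cong) (simp add: ennreal_mult[symmetric] Knn[OF t] exp_minus)
    also have "\<dots> = ennreal (exp 1) * (\<integral>\<^sup>+ g'. ennreal (K t g g' * exp (-1)) \<partial>lborel)"
      using Km by (intro nn_integral_cmult) auto
    also have "\<dots> \<le> ennreal (exp 1) * 2"
      using * unfolding nn_integral_completion by (intro mult_left_mono) auto
    also have "\<dots> = ennreal (2 * exp 1)"
      by (simp add: ennreal_mult mult.commute)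
    finally show "(\<integral>\<^sup>+ g'. ennreal (K t g g') \<partial>lebesgue) \<le> ennreal (2 * exp 1)" .
  qed
qed

section \<open>Boundedness of the heat energy\<close>

lemma powr_abs_diff_le:
  fixes a b p :: real
  assumes "p \<ge> 0"
  shows "\<bar>a - b\<bar> powr p \<le> 2 powr p * (\<bar>a\<bar> powr p + \<bar>b\<bar> powr p)"
proof -
  have "\<bar>a - b\<bar> powr p \<le> (2 * max \<bar>a\<bar> \<bar>b\<bar>) powr p"
    by (rule powr_mono2) (use assms in auto)
  also have "\<dots> = 2 powr p * max \<bar>a\<bar> \<bar>b\<bar> powr p"
    by (simp add: powr_mult)
  also have "max \<bar>a\<bar> \<bar>b\<bar> powr p \<le> \<bar>a\<bar> powr p + \<bar>b\<bar> powr p"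
    by (simp add: max_def)
  finally show ?thesis by simp
qed

text \<open>After the pointwise estimate of \<open>\<bar>u h - u g\<bar> powr p\<close> one of the two terms has the mass of \<open>K t g\<close> as its
  inner integral, and so has the other after exchanging the integrals and using symmetry.\<close>
lemma heat_energy_bound:
  fixes K :: "real \<Rightarrow> 'a::euclidean_space \<Rightarrow> 'a \<Rightarrow> real"
  assumes meas: "(\<lambda>(g, g'). K t g g') \<in> borel_measurable borel"
    and nonneg: "\<And>g g'. K t g g' \<ge> 0"
    and sym: "\<And>g g'. K t g g' = K t g' g"
    and mass: "AE g in lebesgue. (\<integral>\<^sup>+ g'. ennreal (K t g g') \<partial>lebesgue) \<le> ennreal M"
    and p: "p \<ge> 0" and u: "u \<in> Lp p"
  shows "heat_energy K p u t
    \<le> ennreal (2 powr p) * (2 * (ennreal M * (\<integral>\<^sup>+ g. ennreal (\<bar>u g\<bar> powr p) \<partial>lebesgue)))"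
proof -
  have meas2: "(\<lambda>(g, g'). K t g g') \<in> borel_measurable (lborel \<Otimes>\<^sub>M lborel)"
    using meas by (simp add: lborel_prod)
  have K_meas[measurable]: "(\<lambda>g'. K t g g') \<in> borel_measurable borel" for g
  proof -
    have "(\<lambda>g'. (g, g')) \<in> borel_measurable borel"
      by (intro borel_measurable_continuous_onI continuous_intros)
    from measurable_compose[OF this meas] show ?thesis by simp
  qed
  define U where "U = (\<lambda>g. ennreal (\<bar>u g\<bar> powr p))"
  have U_leb: "U \<in> borel_measurable lebesgue"
    using u by (auto simp: U_def Lp_def)
  \<comment> \<open>Tonelli on the product needs a Borel representative of \<open>\<bar>u\<bar> powr p\<close>.\<close>
  then obtain v where v[measurable]: "v \<in> borel_measurable lborel" and Uv: "AE g in lborel. U g = v g"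
    using completion_ex_borel_measurable by blast
  have mass': "AE g in lborel. (\<integral>\<^sup>+ g'. ennreal (K t g g') \<partial>lborel) \<le> ennreal M"
    using mass by (simp add: AE_completion_iff nn_integral_completion)
  have KUm: "(\<lambda>(g, g'). ennreal (K t g g') * v g') \<in> borel_measurable (lborel \<Otimes>\<^sub>M lborel)"
  proof -
    have "(\<lambda>z. ennreal ((\<lambda>(g, g'). K t g g') z) * v (snd z)) \<in> borel_measurable (lborel \<Otimes>\<^sub>M lborel)"
      by (intro borel_measurable_times_ennreal measurable_compose[OF meas2 measurable_ennreal]
          measurable_compose[OF measurable_snd v])
    then show ?thesis by (simp add: case_prod_beta)
  qed
  have inner: "heat_apply K t (\<lambda>g'. \<bar>u g' - u g\<bar> powr p) g
      \<le> ennreal (2 powr p) * ((\<integral>\<^sup>+ g'. ennreal (K t g g') * v g' \<partial>lborel)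
          + U g * (\<integral>\<^sup>+ g'. ennreal (K t g g') \<partial>lborel))" for g
  proof -
    have "heat_apply K t (\<lambda>g'. \<bar>u g' - u g\<bar> powr p) g
      = (\<integral>\<^sup>+ g'. ennreal (K t g g' * \<bar>u g' - u g\<bar> powr p) \<partial>lborel)"
      by (simp add: heat_apply_def nn_integral_completion)
    also have "\<dots> \<le> (\<integral>\<^sup>+ g'. ennreal (2 powr p) * (ennreal (K t g g') * v g'
          + U g * ennreal (K t g g')) \<partial>lborel)"
    proof (rule nn_integral_mono_AE)
      show "AE g' in lborel. ennreal (K t g g' * \<bar>u g' - u g\<bar> powr p)
        \<le> ennreal (2 powr p) * (ennreal (K t g g') * v g' + U g * ennreal (K t g g'))"
        using Uv
      proof eventually_elim
        fix g' assume e: "U g' = v g'"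
        have "K t g g' * \<bar>u g' - u g\<bar> powr p \<le> K t g g' * (2 powr p * (\<bar>u g'\<bar> powr p + \<bar>u g\<bar> powr p))"
          by (intro mult_left_mono powr_abs_diff_le p nonneg)
        then have "ennreal (K t g g' * \<bar>u g' - u g\<bar> powr p)
            \<le> ennreal (2 powr p * (K t g g' * \<bar>u g'\<bar> powr p + \<bar>u g\<bar> powr p * K t g g'))"
          by (intro ennreal_leI) (simp add: algebra_simps)
        also have "\<dots> = ennreal (2 powr p) * (ennreal (K t g g') * v g' + U g * ennreal (K t g g'))"
          unfolding e[symmetric] U_def using nonneg by (simp add: ennreal_mult ennreal_plus)
        finally show "ennreal (K t g g' * \<bar>u g' - u g\<bar> powr p) \<le> \<dots>" .
      qed
    qed
    also have "\<dots> = ennreal (2 powr p) * ((\<integral>\<^sup>+ g'. ennreal (K t g g') * v g' \<partial>lborel)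
          + U g * (\<integral>\<^sup>+ g'. ennreal (K t g g') \<partial>lborel))"
      by (simp add: nn_integral_cmult nn_integral_add)
    finally show ?thesis .
  qed
  have swap: "(\<integral>\<^sup>+ g. (\<integral>\<^sup>+ g'. ennreal (K t g g') * v g' \<partial>lborel) \<partial>lborel)
      \<le> ennreal M * (\<integral>\<^sup>+ g. v g \<partial>lborel)"
  proof -
    have "(\<integral>\<^sup>+ g. (\<integral>\<^sup>+ g'. ennreal (K t g g') * v g' \<partial>lborel) \<partial>lborel)
        = (\<integral>\<^sup>+ g'. (\<integral>\<^sup>+ g. ennreal (K t g g') * v g' \<partial>lborel) \<partial>lborel)"
      by (rule lborel_pair.Fubini'[OF KUm, symmetric])
    also have "\<dots> = (\<integral>\<^sup>+ g'. (\<integral>\<^sup>+ g. ennreal (K t g' g) \<partial>lborel) * v g' \<partial>lborel)"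
      by (subst sym) (simp add: nn_integral_multc)
    also have "\<dots> \<le> (\<integral>\<^sup>+ g'. ennreal M * v g' \<partial>lborel)"
      by (rule nn_integral_mono_AE) (use mass' in eventually_elim, auto intro: mult_right_mono)
    finally show ?thesis by (simp add: nn_integral_cmult)
  qed
  have "heat_energy K p u t \<le> (\<integral>\<^sup>+ g. ennreal (2 powr p) *
      ((\<integral>\<^sup>+ g'. ennreal (K t g g') * v g' \<partial>lborel) + ennreal M * v g) \<partial>lborel)"
    unfolding heat_energy_def nn_integral_completion
  proof (rule nn_integral_mono_AE)
    show "AE g in lborel. heat_apply K t (\<lambda>g'. \<bar>u g' - u g\<bar> powr p) g \<le> ennreal (2 powr p) *
      ((\<integral>\<^sup>+ g'. ennreal (K t g g') * v g' \<partial>lborel) + ennreal M * v g)"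
      using mass' Uv
    proof eventually_elim
      fix g assume m: "(\<integral>\<^sup>+ g'. ennreal (K t g g') \<partial>lborel) \<le> ennreal M" and e: "U g = v g"
      show "heat_apply K t (\<lambda>g'. \<bar>u g' - u g\<bar> powr p) g \<le> ennreal (2 powr p) *
        ((\<integral>\<^sup>+ g'. ennreal (K t g g') * v g' \<partial>lborel) + ennreal M * v g)"
      proof (rule order_trans[OF inner], intro mult_left_mono add_left_mono)
        show "U g * (\<integral>\<^sup>+ g'. ennreal (K t g g') \<partial>lborel) \<le> ennreal M * v g"
          using mult_right_mono[OF m, of "v g"] by (simp add: e mult.commute)
      qed auto
    qed
  qed
  also have "\<dots> = ennreal (2 powr p) *
      ((\<integral>\<^sup>+ g. (\<integral>\<^sup>+ g'. ennreal (K t g g') * v g' \<partial>lborel) \<partial>lborel) + ennreal M * (\<integral>\<^sup>+ g. v g \<partial>lborel))"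
  proof -
    have [measurable]: "(\<lambda>g. \<integral>\<^sup>+ g'. ennreal (K t g g') * v g' \<partial>lborel) \<in> borel_measurable lborel"
      by (rule lborel.borel_measurable_nn_integral[OF KUm])
    show ?thesis by (simp add: nn_integral_cmult nn_integral_add)
  qed
  also have "\<dots> \<le> ennreal (2 powr p) * (2 * (ennreal M * (\<integral>\<^sup>+ g. v g \<partial>lborel)))"
    unfolding mult_2 by (intro mult_left_mono add_right_mono swap) auto
  also have "(\<integral>\<^sup>+ g. v g \<partial>lborel) = (\<integral>\<^sup>+ g. U g \<partial>lborel)"
    by (rule nn_integral_cong_AE) (use Uv in auto)
  finally show ?thesis by (simp add: U_def nn_integral_completion)
qed

lemma grushin_heat_energy_bounded:
  fixes K :: "real \<Rightarrow> ('m::finite, 'k::finite) grushin_space \<Rightarrow> ('m, 'k) grushin_space \<Rightarrow> real"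
  assumes \<alpha>: "\<alpha> \<ge> 0" and K: "is_grushin_heat_kernel \<alpha> K" and p: "p \<ge> 0" and u: "u \<in> Lp p"
  obtains C where "C \<ge> 0" "\<And>t. t > 0 \<Longrightarrow> heat_energy K p u t \<le> ennreal C"
proof -
  have fin: "(\<integral>\<^sup>+ g. ennreal (\<bar>u g\<bar> powr p) \<partial>lebesgue) = ennreal (LINT g|lebesgue. \<bar>u g\<bar> powr p)"
    using u by (intro nn_integral_eq_integral) (auto simp: Lp_def)
  show thesis
  proof (rule that[of "2 powr p * (2 * (2 * exp 1 * (LINT g|lebesgue. \<bar>u g\<bar> powr p)))"])
    have "(LINT g|lebesgue. \<bar>u g\<bar> powr p) \<ge> 0" by (intro integral_nonneg_AE) auto
    then show "0 \<le> 2 powr p * (2 * (2 * exp 1 * (LINT g|lebesgue. \<bar>u g\<bar> powr p)))" by simp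
    fix t :: real assume t: "t > 0"
    have "heat_energy K p u t \<le> ennreal (2 powr p) *
        (2 * (ennreal (2 * exp 1) * (\<integral>\<^sup>+ g. ennreal (\<bar>u g\<bar> powr p) \<partial>lebesgue)))"
    proof (rule heat_energy_bound[where K = K and t = t])
      show "K t g g' \<ge> 0" "K t g g' = K t g' g" for g g'
        using K t unfolding is_grushin_heat_kernel_def by blast+
    qed (rule grushin_heat_kernel_measurable[OF K t] grushin_heat_kernel_mass[OF \<alpha> K t] p u)+
    also have "\<dots> = ennreal (2 powr p * (2 * (2 * exp 1 * (LINT g|lebesgue. \<bar>u g\<bar> powr p))))"
      unfolding fin ennreal_numeral[symmetric] using \<open>(LINT g|lebesgue. \<bar>u g\<bar> powr p) \<ge> 0\<close>
      by (simp add: ennreal_mult[symmetric] del: ennreal_numeral)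
    finally show "heat_energy K p u t \<le> \<dots>" .
  qed
qed

section \<open>Abelian limits\<close>

lemma set_nn_integral_powr_near_0:
  fixes \<delta> a :: real
  assumes "\<delta> > 0" "a > 0"
  shows "(\<integral>\<^sup>+ t\<in>{0<..\<delta>}. ennreal (t powr (a - 1)) \<partial>lborel) = ennreal (\<delta> powr a / a)"
proof -
  have "((\<lambda>t. t powr (a - 1)) has_integral (\<delta> powr (a - 1 + 1) / (a - 1 + 1))) {0..\<delta>}"
    using assms by (intro has_integral_powr_from_0) auto
  from nn_integral_has_integral_lebesgue[OF _ this]
  have "(\<integral>\<^sup>+ t. ennreal (indicator {0..\<delta>} t * t powr (a - 1)) \<partial>lborel) = ennreal (\<delta> powr a / a)"
    by simp
  moreover have "(\<integral>\<^sup>+ t\<in>{0<..\<delta>}. ennreal (t powr (a - 1)) \<partial>lborel)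
      = (\<integral>\<^sup>+ t. ennreal (indicator {0..\<delta>} t * t powr (a - 1)) \<partial>lborel)"

    by (intro nn_integral_cong) (auto simp: indicator_def)
  ultimately show ?thesis by simp
qed

lemma set_nn_integral_powr_near_infinity:
  fixes \<delta> b :: real
  assumes "\<delta> > 0" "b > 0"
  shows "(\<integral>\<^sup>+ t\<in>{\<delta><..}. ennreal (t powr (- b - 1)) \<partial>lborel) \<le> ennreal (\<delta> powr (- b) / b)"
proof -
  have "((\<lambda>t. t powr (- b - 1)) has_integral (- (\<delta> powr (- b - 1 + 1)) / (- b - 1 + 1))) {\<delta>..}"
    using assms by (intro has_integral_powr_to_inf) auto
  from nn_integral_has_integral_lebesgue[OF _ this]
  have "(\<integral>\<^sup>+ t. ennreal (indicator {\<delta>..} t * t powr (- b - 1)) \<partial>lborel) = ennreal (\<delta> powr (- b) / b)"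
    by simp
  moreover have "(\<integral>\<^sup>+ t\<in>{\<delta><..}. ennreal (t powr (- b - 1)) \<partial>lborel)
      \<le> (\<integral>\<^sup>+ t. ennreal (indicator {\<delta>..} t * t powr (- b - 1)) \<partial>lborel)"

    by (intro nn_integral_mono) (auto simp: indicator_def)
  ultimately show ?thesis by simp
qed

text \<open>Only the range \<open>t \<le> \<delta>\<close> is kept, where \<open>E t \<ge> r * t powr (p / 2)\<close> for any \<open>r\<close> below the lower limit.\<close>
lemma abelian_liminf:
  fixes E :: "real \<Rightarrow> ennreal" and p :: real
  assumes p: "p > 0"
  shows "ennreal (2 / p) * Liminf (at_right 0) (\<lambda>t. ennreal (t powr (- p / 2)) * E t)
    \<le> Liminf (at_left 1) (\<lambda>\<beta>. ennreal (1 - \<beta>) *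
        (\<integral>\<^sup>+ t\<in>{0<..}. (E t * ennreal (1 / t powr (\<beta> * p / 2 + 1))) \<partial>lborel))"
    (is "_ * ?L \<le> ?Z")
proof -
  have "?L \<le> ennreal (p / 2) * ?Z"
  proof (rule dense_le)
    fix c assume c: "c < ?L"
    then obtain r where r: "c = ennreal r" "r \<ge> 0"
      by (cases c) auto
    from c have "eventually (\<lambda>t. c < ennreal (t powr (- p / 2)) * E t) (at_right 0)"
      using less_LiminfD by blast
    then obtain \<delta>' where \<delta>': "\<delta>' > 0"
      "\<And>t. t > 0 \<Longrightarrow> t < \<delta>' \<Longrightarrow> c < ennreal (t powr (- p / 2)) * E t"
      unfolding eventually_at_right_field by auto
    define \<delta> where "\<delta> = \<delta>' / 2"
    have \<delta>: "\<delta> > 0" using \<delta>' by (simp add: \<delta>_def)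
    have Elow: "ennreal (r * t powr (p / 2)) \<le> E t" if t: "t \<in> {0<..\<delta>}" for t
    proof -
      from \<delta>'(2)[of t] t have "c < ennreal (t powr (- p / 2)) * E t"
        using \<delta>' by (auto simp: \<delta>_def)
      then have "ennreal (t powr (p / 2)) * c \<le> ennreal (t powr (p / 2)) * (ennreal (t powr (- p / 2)) * E t)"
        by (intro mult_left_mono) auto
      also have "\<dots> = E t"
        using t by (simp add: mult.assoc[symmetric] ennreal_mult[symmetric] powr_add[symmetric])
      finally show ?thesis
        using r by (simp add: ennreal_mult mult.commute)
    qed
    have low: "ennreal (2 / p * r * \<delta> powr (p * (1 - \<beta>) / 2)) \<le> ennreal (1 - \<beta>) *
        (\<integral>\<^sup>+ t\<in>{0<..}. (E t * ennreal (1 / t powr (\<beta> * p / 2 + 1))) \<partial>lborel)"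
      if \<beta>: "\<beta> < 1" for \<beta>
    proof -
      define a where "a = p * (1 - \<beta>) / 2"
      have a: "a > 0" using p \<beta> by (simp add: a_def)
      have "ennreal r * ennreal (\<delta> powr a / a)
          = ennreal r * (\<integral>\<^sup>+ t\<in>{0<..\<delta>}. ennreal (t powr (a - 1)) \<partial>lborel)"
        using set_nn_integral_powr_near_0[OF \<delta> a] by simp
      also have "\<dots> = (\<integral>\<^sup>+ t\<in>{0<..\<delta>}. (ennreal r * ennreal (t powr (a - 1))) \<partial>lborel)"
        by (subst nn_integral_cmult[symmetric]) (auto simp: mult.assoc)
      also have "\<dots> \<le> (\<integral>\<^sup>+ t\<in>{0<..}. (E t * ennreal (1 / t powr (\<beta> * p / 2 + 1))) \<partial>lborel)"
      proof (intro nn_integral_mono)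
        fix t :: real
        show "ennreal r * ennreal (t powr (a - 1)) * indicator {0<..\<delta>} t
          \<le> E t * ennreal (1 / t powr (\<beta> * p / 2 + 1)) * indicator {0<..} t"
        proof (cases "t \<in> {0<..\<delta>}")
          case True
          have "a - 1 = p / 2 + - (\<beta> * p / 2 + 1)" by (simp add: a_def field_simps)
          then have "t powr (a - 1) = t powr (p / 2) * t powr (- (\<beta> * p / 2 + 1))"
            by (metis powr_add)
          also have "\<dots> = t powr (p / 2) * (1 / t powr (\<beta> * p / 2 + 1))"
            unfolding powr_minus_divide ..
          finally have e: "t powr (a - 1) = t powr (p / 2) * (1 / t powr (\<beta> * p / 2 + 1))" .
          have "ennreal r * ennreal (t powr (a - 1))
              = ennreal (r * t powr (p / 2)) * ennreal (1 / t powr (\<beta> * p / 2 + 1))"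
            unfolding e using r by (simp add: ennreal_mult[symmetric] mult.assoc)
          also have "\<dots> \<le> E t * ennreal (1 / t powr (\<beta> * p / 2 + 1))"
            by (intro mult_right_mono Elow True) auto
          finally show ?thesis using True by simp
        qed auto
      qed
      finally have "ennreal (1 - \<beta>) * (ennreal r * ennreal (\<delta> powr a / a)) \<le> ennreal (1 - \<beta>) *
        (\<integral>\<^sup>+ t\<in>{0<..}. (E t * ennreal (1 / t powr (\<beta> * p / 2 + 1))) \<partial>lborel)"
        by (intro mult_left_mono) auto
      moreover have "ennreal (1 - \<beta>) * (ennreal r * ennreal (\<delta> powr a / a))
          = ennreal (2 / p * r * \<delta> powr (p * (1 - \<beta>) / 2))"
      proof -
        have "(1 - \<beta>) * (r * (\<delta> powr a / a)) = 2 / p * r * \<delta> powr a"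
          using p \<beta> by (simp add: a_def)
        then show ?thesis
          using \<beta> r a unfolding a_def[symmetric] by (simp add: ennreal_mult[symmetric])
      qed
      ultimately show ?thesis by simp
    qed
    have "((\<lambda>\<beta>. ennreal (2 / p * r * \<delta> powr (p * (1 - \<beta>) / 2))) \<longlongrightarrow>
        ennreal (2 / p * r * \<delta> powr (p * (1 - 1) / 2))) (at_left 1)"
      by (intro tendsto_intros) (use \<delta> in auto)
    then have "Liminf (at_left 1) (\<lambda>\<beta>. ennreal (2 / p * r * \<delta> powr (p * (1 - \<beta>) / 2)))
        = ennreal (2 / p * r)"
      using \<delta> by (subst lim_imp_Liminf) auto
    moreover have "Liminf (at_left 1) (\<lambda>\<beta>. ennreal (2 / p * r * \<delta> powr (p * (1 - \<beta>) / 2))) \<le> ?Z"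
      by (intro Liminf_mono eventually_at_leftI[of 0] low) auto
    ultimately have "ennreal (p / 2) * ennreal (2 / p * r) \<le> ennreal (p / 2) * ?Z"
      by (intro mult_left_mono) auto
    moreover have "ennreal (p / 2) * ennreal (2 / p * r) = c"
      using p r by (simp add: ennreal_mult[symmetric])
    ultimately show "c \<le> ennreal (p / 2) * ?Z" by simp
  qed
  then have "ennreal (2 / p) * ?L \<le> ennreal (2 / p) * (ennreal (p / 2) * ?Z)"
    by (intro mult_left_mono) auto
  also have "\<dots> = ?Z"
    using p by (simp add: mult.assoc[symmetric] ennreal_mult[symmetric])
  finally show ?thesis .
qed

text \<open>Near zero \<open>E t \<le> r * t powr (p / 2)\<close> for any \<open>r\<close> above the upper limit. Beyond \<open>\<delta>\<close> the bound \<open>C\<close> gives a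
  contribution that stays bounded as \<open>\<beta>\<close> tends to one, and the factor \<open>1 - \<beta>\<close> removes it.\<close>
lemma abelian_limsup:
  fixes E :: "real \<Rightarrow> ennreal" and p C :: real
  assumes p: "p > 0" and C: "C \<ge> 0" and EC: "\<And>t. t > 0 \<Longrightarrow> E t \<le> ennreal C"
  shows "Limsup (at_left 1) (\<lambda>\<beta>. ennreal (1 - \<beta>) *
        (\<integral>\<^sup>+ t\<in>{0<..}. (E t * ennreal (1 / t powr (\<beta> * p / 2 + 1))) \<partial>lborel))
    \<le> ennreal (2 / p) * Limsup (at_right 0) (\<lambda>t. ennreal (t powr (- p / 2)) * E t)"
    (is "?Z \<le> _ * ?L")
proof -
  have "ennreal (p / 2) * ?Z \<le> ?L"
  proof (rule dense_ge)
    fix c assume c: "?L < c"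
    show "ennreal (p / 2) * ?Z \<le> c"
    proof (cases c)
      case (real r)
      from c have "eventually (\<lambda>t. ennreal (t powr (- p / 2)) * E t < c) (at_right 0)"
        using Limsup_lessD by blast
      then obtain \<delta>' where \<delta>': "\<delta>' > 0"
        "\<And>t. t > 0 \<Longrightarrow> t < \<delta>' \<Longrightarrow> ennreal (t powr (- p / 2)) * E t < c"
        unfolding eventually_at_right_field by auto
      define \<delta> where "\<delta> = \<delta>' / 2"
      have \<delta>: "\<delta> > 0" using \<delta>' by (simp add: \<delta>_def)
      have Eup: "E t \<le> ennreal (r * t powr (p / 2))" if t: "t \<in> {0<..\<delta>}" for t
      proof -
        from \<delta>'(2)[of t] t have "ennreal (t powr (- p / 2)) * E t < c"
          using \<delta>' by (auto simp: \<delta>_def)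
        then have "ennreal (t powr (p / 2)) * (ennreal (t powr (- p / 2)) * E t) \<le> ennreal (t powr (p / 2)) * c"
          by (intro mult_left_mono) auto
        also have "ennreal (t powr (p / 2)) * (ennreal (t powr (- p / 2)) * E t) = E t"
          using t by (simp add: mult.assoc[symmetric] ennreal_mult[symmetric] powr_add[symmetric])
        finally show ?thesis
          using real by (simp add: ennreal_mult mult.commute)
      qed
      define up where "up = (\<lambda>\<beta>. 2 / p * r * \<delta> powr (p * (1 - \<beta>) / 2)
          + (1 - \<beta>) * (C * (\<delta> powr (- (\<beta> * p / 2)) / (\<beta> * p / 2))))"
      have up: "ennreal (1 - \<beta>) *
          (\<integral>\<^sup>+ t\<in>{0<..}. (E t * ennreal (1 / t powr (\<beta> * p / 2 + 1))) \<partial>lborel) \<le> ennreal (up \<beta>)"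
        if \<beta>: "\<beta> < 1" "0 < \<beta>" for \<beta>
      proof -
        define a where "a = p * (1 - \<beta>) / 2"
        define b where "b = \<beta> * p / 2"
        have a: "a > 0" using p \<beta> by (simp add: a_def)
        have b: "b > 0" using p \<beta> by (simp add: b_def)
        have "(\<integral>\<^sup>+ t\<in>{0<..}. (E t * ennreal (1 / t powr (\<beta> * p / 2 + 1))) \<partial>lborel)
          \<le> (\<integral>\<^sup>+ t. (ennreal r * (ennreal (t powr (a - 1)) * indicator {0<..\<delta>} t)
              + ennreal C * (ennreal (t powr (- b - 1)) * indicator {\<delta><..} t)) \<partial>lborel)"
        proof (intro nn_integral_mono)
          fix t :: real
          have m: "1 / t powr (\<beta> * p / 2 + 1) = t powr (- b - 1)"
            unfolding b_def powr_minus_divide[symmetric] by simp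
          show "E t * ennreal (1 / t powr (\<beta> * p / 2 + 1)) * indicator {0<..} t
            \<le> ennreal r * (ennreal (t powr (a - 1)) * indicator {0<..\<delta>} t)
              + ennreal C * (ennreal (t powr (- b - 1)) * indicator {\<delta><..} t)"
          proof -
            consider "t \<le> 0" | "t \<in> {0<..\<delta>}" | "t > \<delta>" by force
            then show ?thesis
            proof cases
              case 2
              have "a - 1 = p / 2 + (- b - 1)" by (simp add: a_def b_def field_simps)
              then have e: "t powr (a - 1) = t powr (p / 2) * t powr (- b - 1)"
                by (metis powr_add)
              have "E t * ennreal (t powr (- b - 1))
                  \<le> ennreal (r * t powr (p / 2)) * ennreal (t powr (- b - 1))"
                by (intro mult_right_mono Eup 2) auto
              also have "\<dots> = ennreal r * ennreal (t powr (a - 1))"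
                unfolding e using real by (simp add: ennreal_mult[symmetric] mult.assoc)
              finally show ?thesis unfolding m using 2 by simp
            next
              case 3
              then have "E t * ennreal (t powr (- b - 1)) \<le> ennreal C * ennreal (t powr (- b - 1))"
                using \<delta> by (intro mult_right_mono EC) auto
              then show ?thesis unfolding m using 3 \<delta> by simp
            qed simp
          qed
        qed
        also have "\<dots> = ennreal r * (\<integral>\<^sup>+ t\<in>{0<..\<delta>}. ennreal (t powr (a - 1)) \<partial>lborel)
            + ennreal C * (\<integral>\<^sup>+ t\<in>{\<delta><..}. ennreal (t powr (- b - 1)) \<partial>lborel)"
          by (subst nn_integral_add) (auto simp: nn_integral_cmult)
        also have "\<dots> \<le> ennreal r * ennreal (\<delta> powr a / a) + ennreal C * ennreal (\<delta> powr (- b) / b)"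
          using set_nn_integral_powr_near_0[OF \<delta> a] set_nn_integral_powr_near_infinity[OF \<delta> b]
          by (intro add_mono mult_left_mono) auto
        also have "\<dots> = ennreal (r * (\<delta> powr a / a) + C * (\<delta> powr (- b) / b))"
          using real C a b by (simp add: ennreal_mult[symmetric] ennreal_plus[symmetric] del: ennreal_plus)
        finally have "ennreal (1 - \<beta>) *
            (\<integral>\<^sup>+ t\<in>{0<..}. (E t * ennreal (1 / t powr (\<beta> * p / 2 + 1))) \<partial>lborel)
            \<le> ennreal (1 - \<beta>) * ennreal (r * (\<delta> powr a / a) + C * (\<delta> powr (- b) / b))"
          by (intro mult_left_mono) auto
        also have "\<dots> = ennreal ((1 - \<beta>) * (r * (\<delta> powr a / a) + C * (\<delta> powr (- b) / b)))"
          using \<beta> real C a b by (simp add: ennreal_mult)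
        also have "(1 - \<beta>) * (r * (\<delta> powr a / a) + C * (\<delta> powr (- b) / b)) = up \<beta>"
        proof -
          have "(1 - \<beta>) * (r * (\<delta> powr a / a)) = 2 / p * r * \<delta> powr a"
            using p \<beta> by (simp add: a_def)
          then show ?thesis
            unfolding up_def a_def[symmetric] b_def[symmetric] by (simp add: distrib_left)
        qed
        finally show ?thesis .
      qed
      have "((\<lambda>\<beta>. ennreal (up \<beta>)) \<longlongrightarrow> ennreal (2 / p * r * \<delta> powr (p * (1 - 1) / 2)
          + (1 - 1) * (C * (\<delta> powr (- (1 * p / 2)) / (1 * p / 2))))) (at_left 1)"
        unfolding up_def by (intro tendsto_intros) (use \<delta> p in auto)
      then have "Limsup (at_left 1) (\<lambda>\<beta>. ennreal (up \<beta>)) = ennreal (2 / p * r)"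
        using \<delta> by (subst lim_imp_Limsup) auto
      moreover have "?Z \<le> Limsup (at_left 1) (\<lambda>\<beta>. ennreal (up \<beta>))"
      proof (intro Limsup_mono)
        have "eventually (\<lambda>\<beta>::real. \<beta> \<in> {0<..<1}) (at_left 1)"
          by (rule eventually_at_leftI[of 0]) auto
        then show "\<forall>\<^sub>F \<beta> in at_left 1. ennreal (1 - \<beta>) *
            (\<integral>\<^sup>+ t\<in>{0<..}. (E t * ennreal (1 / t powr (\<beta> * p / 2 + 1))) \<partial>lborel) \<le> ennreal (up \<beta>)"
          by eventually_elim (auto intro: up)
      qed
      ultimately have "ennreal (p / 2) * ?Z \<le> ennreal (p / 2) * ennreal (2 / p * r)"
        by (intro mult_left_mono) auto
      also have "\<dots> = c"
        using p real by (simp add: ennreal_mult[symmetric])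
      finally show ?thesis .
    qed auto
  qed
  then have "ennreal (2 / p) * (ennreal (p / 2) * ?Z) \<le> ennreal (2 / p) * ?L"
    by (intro mult_left_mono) auto
  moreover have "ennreal (2 / p) * (ennreal (p / 2) * ?Z) = ?Z"
    using p by (simp add: mult.assoc[symmetric] ennreal_mult[symmetric])
  ultimately show ?thesis by simp
qed

section \<open>The Besov semi-norm as the differentiability parameter tends to one\<close>

lemma ennreal_rpow_inverse:
  assumes "a > 0"
  shows "ennreal_rpow (ennreal_rpow x (1 / a)) a = x"
proof (cases x)
  case (real r)
  with assms show ?thesis
    by (auto simp: ennreal_rpow_def powr_powr)
qed (auto simp: ennreal_rpow_def)

lemma besov_seminorm_powr:
  assumes "p > 0"
  shows "ennreal_rpow (besov_seminorm K p \<beta> u) p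
    = (\<integral>\<^sup>+ t\<in>{0<..}. (heat_energy K p u t * ennreal (1 / t powr (\<beta> * p / 2 + 1))) \<partial>lborel)"
  unfolding besov_seminorm_def ennreal_rpow_inverse[OF assms] nn_integral_completion ..

theorem proposition3p22:
  fixes \<alpha> p :: real
    and K :: "real \<Rightarrow> ('m::finite, 'k::finite) grushin_space \<Rightarrow> ('m, 'k) grushin_space \<Rightarrow> real"
    and u :: "('m, 'k) grushin_space \<Rightarrow> real"
  assumes "\<alpha> \<ge> 0"
    and "is_grushin_heat_kernel \<alpha> K"
    and "p \<ge> 1"
    and "u \<in> Lp p"
  shows "ennreal (2 / p) * Liminf (at_right 0) (\<lambda>t. ennreal (t powr (- p / 2)) * heat_energy K p u t)
           \<le> Liminf (at_left 1) (\<lambda>\<beta>. ennreal (1 - \<beta>) * ennreal_rpow (besov_seminorm K p \<beta> u) p)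
       \<and> Liminf (at_left 1) (\<lambda>\<beta>. ennreal (1 - \<beta>) * ennreal_rpow (besov_seminorm K p \<beta> u) p)
           \<le> Limsup (at_left 1) (\<lambda>\<beta>. ennreal (1 - \<beta>) * ennreal_rpow (besov_seminorm K p \<beta> u) p)
       \<and> Limsup (at_left 1) (\<lambda>\<beta>. ennreal (1 - \<beta>) * ennreal_rpow (besov_seminorm K p \<beta> u) p)
           \<le> ennreal (2 / p) * Limsup (at_right 0) (\<lambda>t. ennreal (t powr (- p / 2)) * heat_energy K p u t)
       \<and> (\<forall>l. ((\<lambda>\<beta>. ennreal (1 - \<beta>) * ennreal_rpow (besov_seminorm K p \<beta> u) p) \<longlongrightarrow> l) (at_left 1) \<longrightarrow>
             ennreal (2 / p) * Liminf (at_right 0) (\<lambda>t. ennreal (t powr (- p / 2)) * heat_energy K p u t) \<le> l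
           \<and> l \<le> ennreal (2 / p) * Limsup (at_right 0) (\<lambda>t. ennreal (t powr (- p / 2)) * heat_energy K p u t))"
proof -
  let ?F = "\<lambda>\<beta>. ennreal (1 - \<beta>) * ennreal_rpow (besov_seminorm K p \<beta> u) p"
  have p: "p > 0" using assms(3) by simp
  obtain C where C: "C \<ge> 0" "\<And>t. t > 0 \<Longrightarrow> heat_energy K p u t \<le> ennreal C"
    using grushin_heat_energy_bounded[OF assms(1,2) _ assms(4)] p by auto
  have low: "ennreal (2 / p) * Liminf (at_right 0) (\<lambda>t. ennreal (t powr (- p / 2)) * heat_energy K p u t)
      \<le> Liminf (at_left 1) ?F"
    unfolding besov_seminorm_powr[OF p] by (rule abelian_liminf[OF p])
  have mid: "Liminf (at_left 1) ?F \<le> Limsup (at_left 1) ?F"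
    by (rule Liminf_le_Limsup) simp
  have up: "Limsup (at_left 1) ?F
      \<le> ennreal (2 / p) * Limsup (at_right 0) (\<lambda>t. ennreal (t powr (- p / 2)) * heat_energy K p u t)"
    unfolding besov_seminorm_powr[OF p] by (rule abelian_limsup[OF p C])
  have "Liminf (at_left 1) ?F = l \<and> Limsup (at_left 1) ?F = l" if "(?F \<longlongrightarrow> l) (at_left 1)" for l
    using lim_imp_Liminf[OF _ that] lim_imp_Limsup[OF _ that] by simp
  with low mid up show ?thesis by auto
qed

end
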